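(* Let $\mu$ be a complex Borel measure on $\mathbb T$ with deformation $\mu(t)$ (quasi-definite), let $\vec n=(n_+,n_-)$ with integers $n_\pm\ge1$, and let $l\ge|\vec n|=n_++n_-$. Then the deformed orthogonal Laurent polynomials have the $\tau$-function representation $$\varphi_1^{(l)}(z,t)=\varphi_{1,+1}^{(l)}(z,t)=(S_2)_{ll}\,\varphi_{1,-1}^{(l)}(z,t)=z^{\nu_+(l)-1}\frac{\tau^{(l)}(t-[z^{-1}]_1)}{\tau^{(l)}(t)}\quad\text{if }a(l)=1,$$ $$\varphi_1^{(l)}(z,t)=\varphi_{1,+2}^{(l)}(z,t)=(S_2)_{ll}\,\varphi_{1,-2}^{(l)}(z,t)=z^{-\nu_-(l)}\frac{\tau^{(l)}(t+[z]_2)}{\tau^{(l)}(t)}\quad\text{if }a(l)=2;$$ for the other ``$+$'' associated polynomials $$\varphi_{1,+2}^{(l)}(z,t)=z^{-\nu_-(l_{+2})}\frac{\tau^{(l)}(t+[z]_2)}{\tau^{(l)}(t)}\ \text{ if }a(l)=1,\qquad \varphi_{1,+1}^{(l)}(z,t)=z^{\nu_+(l_{+1})-1}\frac{\tau^{(l)}(t-[z^{-1}]_1)}{\tau^{(l)}(t)}\ \text{ if }a(l)=2;$$ and for the remaining ``$-$'' associated polynomials $$\varphi_{1,-2}^{(l)}(z,t)=z^{\nu_+(l)-1}\frac{\tau_{1,-2}^{(l)}(t-[z^{-1}]_1)}{\tau^{(l+1)}(t)}\ \text{ if }a(l)=1,\qquad\varphi_{1,-1}^{(l)}(z,t)=z^{-\nu_-(l)}\frac{\tau_{1,-1}^{(l)}(t+[z]_2)}{\tau^{(l+1)}(t)}\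 \text{ if }a(l)=2.$$
   Context: $\mathbb T$ is the unit circle; a measure is quasi-definite if all its Toeplitz moment matrices $\big(\oint_{\mathbb T}z^{i-j}d\mu\big)_{i,j=0}^n$ are non-singular. Indices start at $0$; $\dagger$ is the conjugate transpose. Deformed measure: $d\mu(t,u)=\exp\big(\sum_{j\ge1}(t_{1j}u^j-t_{2j}u^{-j})\big)d\mu(u)$, with complex parameters $t$ such that the series $\sum_jt_{aj}u^j$ converge for all $u$ and $\mu(t)$ is quasi-definite. Extended ordering: $\chi=\chi_{\vec n}=(1,z,\dots,z^{n_+-1},z^{-1},\dots,z^{-n_-},z^{n_+},\dots,z^{2n_+-1},z^{-n_--1},\dots,z^{-2n_-},\dots)^\top$. $a(l)=1$ if $\chi^{(l)}$ is a non-negative power of $z$, $a(l)=2$ otherwise. $\nu_+(l)$ (resp. $\nu_-(l)$) is the number of $0\le l'\le l$ with $a(l')=1$ (resp. $2$). $l_{+a}$ is the smallest $l'\ge l$ with $a(l')=a$, $l_{-a}$ the largest $l'\le l$ with $a(l')=a$. $g=g(t)=\oint_{\mathbb T}\chi\chi^\dagger d\mu(t)=S_1(t)^{-1}S_2(t)$ with $S_1$ lower unitriangular, $S_2$ upper triangular. $\varphi_1^{(l)}(z,t)=(S_1(t)\chi(z))^{(l)}$. With $g^{[l]}$ the leading $l\times l$ block and $\chi^{[l]}$ the first $l$ components, the associated polynomials are $\varphi_{1,+a}^{(l)}=\chi^{(l_{+a})}-(g_{l_{+a},0},\dots,g_{l_{+a},l-1})(g^{[l]})^{-1}\chi^{[l]}$,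 $\varphi_{1,-a}^{(l)}=e_{l_{-a}}^\top(g^{[l+1]})^{-1}\chi^{[l+1]}$ ($e_j$ canonical basis vectors). $\tau$-functions: $\tau^{(l)}(t)=\det g^{[l]}(t)$; $\tau_{1,-a}^{(l)}(t)=(-1)^{l+l_{-a}}$ times the $l\times l$ minor of $g(t)$ with rows $0,\dots,l-1$ and columns $\{0,\dots,l\}\setminus\{l_{-a}\}$. Miwa shifts: $t\pm[w]_1$ is $t_{1j}\mapsto t_{1j}\pm w^j/j$ ($t_{2j}$ fixed), $t\pm[w]_2$ is $t_{2j}\mapsto t_{2j}\pm w^j/j$ ($t_{1j}$ fixed). A $\tau$-function at $t-[w]_1$ (resp. $t+[w]_2$) is the same determinant built from the measure $(1-wu)\,d\mu(t,u)$ (resp. $(1-w/u)\,d\mu(t,u)$); this is the literal meaning for $|w|<1$ and the polynomial continuation in $w$ otherwise. *)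

theory Defs
  imports
    "HOL-Analysis.Bochner_Integration"
    "HOL-Analysis.Complex_Transcendental"
    "Jordan_Normal_Form.Gauss_Jordan_Elimination"
    "Jordan_Normal_Form.Determinant"
begin

section \<open>Complex Borel measures on the unit circle\<close>

definition circle_algebra :: "complex measure" where
  "circle_algebra = restrict_space borel (sphere 0 1)"

text \<open>A complex measure is a countably additive complex set function; only its values on Borel
  subsets of the circle matter.\<close>

definition complex_borel_measure :: "(complex set \<Rightarrow> complex) \<Rightarrow> bool" where
  "complex_borel_measure \<mu> \<longleftrightarrow>
     \<mu> {} = 0 \<and>
     (\<forall>A :: nat \<Rightarrow> complex set. range A \<subseteq> sets circle_algebra \<longrightarrow> disjoint_family A \<longrightarrow>
        (\<lambda>i. \<mu> (A i)) sums \<mu> (\<Union>i. A i))"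

text \<open>The upper variation \<open>\<nu>\<^sup>+\<close> of a real set function in its Jordan decomposition
  \<open>\<nu> = \<nu>\<^sup>+ - \<nu>\<^sup>-\<close>; the lower one is the upper variation of \<open>-\<nu>\<close>. The function
  \<^const>\<open>ennreal\<close> truncates negative values to \<open>0 = \<nu> {}\<close>, which leaves the supremum unchanged.\<close>

definition upper_variation :: "(complex set \<Rightarrow> real) \<Rightarrow> complex measure" where
  "upper_variation \<nu> = measure_of (sphere 0 1) (sets circle_algebra)
     (\<lambda>A. SUP B \<in> {B \<in> sets circle_algebra. B \<subseteq> A}. ennreal (\<nu> B))"

definition variation_parts :: "(complex set \<Rightarrow> complex) \<Rightarrow> complex measure set" where
  "variation_parts \<mu> =
     {upper_variation (\<lambda>A. Re (\<mu> A)), upper_variation (\<lambda>A. - Re (\<mu> A)),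
      upper_variation (\<lambda>A. Im (\<mu> A)), upper_variation (\<lambda>A. - Im (\<mu> A))}"

definition cm_integrable :: "(complex set \<Rightarrow> complex) \<Rightarrow> (complex \<Rightarrow> complex) \<Rightarrow> bool" where
  "cm_integrable \<mu> f \<longleftrightarrow> (\<forall>M \<in> variation_parts \<mu>. integrable M f)"

definition cm_integral :: "(complex set \<Rightarrow> complex) \<Rightarrow> (complex \<Rightarrow> complex) \<Rightarrow> complex" where
  "cm_integral \<mu> f =
     (integral\<^sup>L (upper_variation (\<lambda>A. Re (\<mu> A))) f
        - integral\<^sup>L (upper_variation (\<lambda>A. - Re (\<mu> A))) f)
     + \<i> * (integral\<^sup>L (upper_variation (\<lambda>A. Im (\<mu> A))) f
        - integral\<^sup>L (upper_variation (\<lambda>A. - Im (\<mu> A))) f)"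

text \<open>The four parts are finite measures that decompose \<open>\<mu>\<close>, so every bounded Borel function is
  integrable.\<close>

locale real_charge =
  fixes \<nu> :: "complex set \<Rightarrow> real"
  assumes empty: "\<nu> {} = 0"
    and sums: "\<And>A :: nat \<Rightarrow> complex set. range A \<subseteq> sets circle_algebra \<Longrightarrow> disjoint_family A \<Longrightarrow>
      (\<lambda>i. \<nu> (A i)) sums \<nu> (\<Union>i. A i)"
begin

definition var :: "complex set \<Rightarrow> ennreal" where
  "var A = (SUP B \<in> {B \<in> sets circle_algebra. B \<subseteq> A}. ennreal (\<nu> B))"

lemma space_circle [simp]: "space circle_algebra = sphere 0 1"
  by (simp add: circle_algebra_def space_restrict_space)

lemma add:
  assumes "A \<in> sets circle_algebra" "B \<in> sets circle_algebra" "A \<inter> B = {}"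
  shows "\<nu> (A \<union> B) = \<nu> A + \<nu> B"
proof -
  have "range (binaryset A B) \<subseteq> sets circle_algebra" "disjoint_family (binaryset A B)"
    using assms by (auto simp: range_binaryset_eq disjoint_family_on_def binaryset_def)
  from sums[OF this] have "(\<lambda>i. \<nu> (binaryset A B i)) sums \<nu> (A \<union> B)"
    by (simp add: UN_binaryset_eq)
  moreover have "(\<lambda>i. \<nu> (binaryset A B i)) sums (\<Sum>i<2. \<nu> (binaryset A B i))"
    by (rule sums_finite) (auto simp: binaryset_def empty)
  ultimately show ?thesis
    by (auto dest: sums_unique2 simp: binaryset_def numeral_2_eq_2)
qed

lemma diff:
  assumes "A \<in> sets circle_algebra" "B \<in> sets circle_algebra" "B \<subseteq> A"
  shows "\<nu> (A - B) = \<nu> A - \<nu> B"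
  using add[of "A - B" B] assms by (simp add: Un_absorb2 sets.Diff Diff_Int_distrib2 Int_commute)

lemma var_upper: "B \<in> sets circle_algebra \<Longrightarrow> B \<subseteq> A \<Longrightarrow> ennreal (\<nu> B) \<le> var A"
  unfolding var_def by (intro SUP_upper) auto

lemma var_least: "(\<And>B. B \<in> sets circle_algebra \<Longrightarrow> B \<subseteq> A \<Longrightarrow> ennreal (\<nu> B) \<le> x) \<Longrightarrow> var A \<le> x"
  unfolding var_def by (intro SUP_least) auto

lemma bounded: obtains c where "\<And>B. B \<in> sets circle_algebra \<Longrightarrow> \<bar>\<nu> B\<bar> \<le> c"
proof -
  define big where "big A \<longleftrightarrow> (\<forall>c. \<exists>B \<in> sets circle_algebra. B \<subseteq> A \<and> \<bar>\<nu> B\<bar> > c)" for A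
  have step: "\<exists>B. (B \<in> sets circle_algebra \<and> big B) \<and> (B \<subseteq> A \<and> \<bar>\<nu> (A - B)\<bar> > 1)"
    if A: "A \<in> sets circle_algebra \<and> big A" for A
  proof -
    obtain C where C: "C \<in> sets circle_algebra" "C \<subseteq> A" "\<bar>\<nu> C\<bar> > 1 + \<bar>\<nu> A\<bar>"
      using A unfolding big_def by blast
    show ?thesis
    proof (cases "big C")
      case True
      have "\<bar>\<nu> (A - C)\<bar> > 1" using C A by (subst diff) auto
      with True C show ?thesis by blast
    next
      case False
      then obtain c0 where c0: "\<And>B. B \<in> sets circle_algebra \<Longrightarrow> B \<subseteq> C \<Longrightarrow> \<bar>\<nu> B\<bar> \<le> c0"
        unfolding big_def by (meson not_less)
      have "big (A - C)"
        unfolding big_def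
      proof
        fix c
        obtain D where D: "D \<in> sets circle_algebra" "D \<subseteq> A" "\<bar>\<nu> D\<bar> > c + c0"
          using A unfolding big_def by blast
        have "\<nu> (D - D \<inter> C) = \<nu> D - \<nu> (D \<inter> C)" using D C by (intro diff) auto
        moreover have "\<bar>\<nu> (D \<inter> C)\<bar> \<le> c0" using D C by (intro c0) auto
        ultimately have "\<bar>\<nu> (D - D \<inter> C)\<bar> > c" using D by linarith
        then show "\<exists>B \<in> sets circle_algebra. B \<subseteq> A - C \<and> \<bar>\<nu> B\<bar> > c"
          using D C by (intro bexI[of _ "D - D \<inter> C"]) auto
      qed
      moreover have "A - (A - C) = C" using C by blast
      ultimately show ?thesis using A C by (intro exI[of _ "A - C"]) auto
    qed
  qed
  have "\<not> big (sphere 0 1)"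
  proof
    assume big: "big (sphere 0 1)"
    have "\<exists>A. \<forall>n. (A n \<in> sets circle_algebra \<and> big (A n)) \<and>
        (A (Suc n) \<subseteq> A n \<and> \<bar>\<nu> (A n - A (Suc n))\<bar> > 1)"
    proof (rule dependent_nat_choice)
      show "\<exists>A. A \<in> sets circle_algebra \<and> big A"
        using big sets.top[of circle_algebra] by auto
    qed (rule step)
    then obtain A where A: "\<And>n. A n \<in> sets circle_algebra" "\<And>n. A (Suc n) \<subseteq> A n"
        "\<And>n. \<bar>\<nu> (A n - A (Suc n))\<bar> > 1"
      by blast
    have dec: "decseq A" using A by (simp add: decseq_Suc_iff)
    have "disjoint_family (\<lambda>n. A n - A (Suc n))"
      unfolding disjoint_family_on_def
    proof (intro ballI impI)
      fix m n :: nat assume "m \<noteq> n"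
      then consider "Suc m \<le> n" | "Suc n \<le> m" by linarith
      then show "(A m - A (Suc m)) \<inter> (A n - A (Suc n)) = {}"
        by cases (use decseqD[OF dec] in blast)+
    qed
    then have "(\<lambda>n. \<nu> (A n - A (Suc n))) sums \<nu> (\<Union>n. A n - A (Suc n))"
      using A by (intro sums) auto
    then have "(\<lambda>n. \<nu> (A n - A (Suc n))) \<longlonglongrightarrow> 0"
      by (intro summable_LIMSEQ_zero sums_summable)
    then have "eventually (\<lambda>n. \<bar>\<nu> (A n - A (Suc n))\<bar> < 1) sequentially"
      by (auto simp: tendsto_iff dist_real_def)
    then show False using A(3) by (auto simp: eventually_sequentially dest: less_asym)
  qed
  then show thesis
    using that sets.sets_into_space[of _ circle_algebra] unfolding big_def by (simp add: not_less) blast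
qed

lemma var_superadd:
  assumes "A \<in> sets circle_algebra" "B \<in> sets circle_algebra" "A \<inter> B = {}"
  shows "var A + var B \<le> var (A \<union> B)"
proof -
  have *: "ennreal (\<nu> C) + ennreal (\<nu> D) \<le> var (A \<union> B)"
    if "C \<in> sets circle_algebra" "D \<in> sets circle_algebra" "C \<subseteq> A" "D \<subseteq> B" for C D
  proof -
    have CD: "\<nu> (C \<union> D) = \<nu> C + \<nu> D" using that assms by (intro add) auto
    consider "\<nu> C \<le> 0" | "\<nu> D \<le> 0" | "\<nu> C \<ge> 0" "\<nu> D \<ge> 0" by linarith
    then show ?thesis
    proof cases
      case 1 then show ?thesis using that by (auto simp: ennreal_neg intro!: var_upper)
    next
      case 2 then show ?thesis using that by (auto simp: ennreal_neg intro!: var_upper)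
    next
      case 3
      then have "ennreal (\<nu> C) + ennreal (\<nu> D) = ennreal (\<nu> (C \<union> D))" by (simp add: CD)
      then show ?thesis using that by (auto intro!: var_upper)
    qed
  qed
  have ne: "{C \<in> sets circle_algebra. C \<subseteq> X} \<noteq> {}" for X by auto
  have "var B + ennreal (\<nu> C) \<le> var (A \<union> B)" if "C \<in> sets circle_algebra" "C \<subseteq> A" for C
    unfolding var_def[of B]
    by (subst ennreal_SUP_add_left[symmetric, OF ne], rule SUP_least)
       (use * that in \<open>force simp: add.commute\<close>)
  then have "var A + var B \<le> var (A \<union> B)"
    unfolding var_def[of A]
    by (subst ennreal_SUP_add_left[symmetric, OF ne], intro SUP_least) (auto simp: add.commute)
  then show ?thesis .
qed

lemma measure_space_var: "measure_space (sphere 0 1) (sets circle_algebra) var"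
  unfolding measure_space_def
proof (intro conjI)
  show "sigma_algebra (sphere 0 1) (sets circle_algebra)"
    using sets.sigma_algebra_axioms[of circle_algebra] by simp
  show "positive (sets circle_algebra) var"
    unfolding positive_def using empty by (simp add: var_def)
  show "countably_additive (sets circle_algebra) var"
    unfolding countably_additive_def
  proof (intro allI impI antisym)
    fix A :: "nat \<Rightarrow> complex set"
    assume A: "range A \<subseteq> sets circle_algebra" "disjoint_family A"
    have part: "(\<Sum>i<n. var (A i)) \<le> var (\<Union>i<n. A i)" for n
    proof (induction n)
      case (Suc n)
      have "(\<Sum>i<Suc n. var (A i)) \<le> var (\<Union>i<n. A i) + var (A n)" using Suc by (simp add: add_right_mono)
      also have "\<dots> \<le> var ((\<Union>i<n. A i) \<union> A n)"
      proof (rule var_superadd)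
        have "A i \<inter> A n = {}" if "i < n" for i
          using disjoint_family_onD[OF A(2), of i n] that by simp
        then show "(\<Union>i<n. A i) \<inter> A n = {}" by blast
      qed (use A in auto)
      also have "(\<Union>i<n. A i) \<union> A n = (\<Union>i<Suc n. A i)" by (auto simp: less_Suc_eq)
      finally show ?case .
    qed simp
    have "var (\<Union>i<n. A i) \<le> var (\<Union>i. A i)" for n
      by (rule var_least, rule var_upper) auto
    then show "(\<Sum>i. var (A i)) \<le> var (\<Union>i. A i)"
      using part by (intro suminf_le_const) (auto intro: order_trans)
    show "var (\<Union>i. A i) \<le> (\<Sum>i. var (A i))"
    proof (rule var_least)
      fix B assume B: "B \<in> sets circle_algebra" "B \<subseteq> (\<Union>i. A i)"
      have "(\<lambda>i. \<nu> (B \<inter> A i)) sums \<nu> (\<Union>i. B \<inter> A i)"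
        using A B by (intro sums) (auto simp: disjoint_family_on_def)
      also have "(\<Union>i. B \<inter> A i) = B" using B by blast
      finally have "(\<lambda>n. ennreal (\<Sum>i<n. \<nu> (B \<inter> A i))) \<longlonglongrightarrow> ennreal (\<nu> B)"
        unfolding sums_def by (rule tendsto_ennrealI)
      moreover have "ennreal (\<Sum>i<n. \<nu> (B \<inter> A i)) \<le> (\<Sum>i. var (A i))" for n
      proof -
        have "ennreal (\<Sum>i<n. \<nu> (B \<inter> A i)) \<le> ennreal (\<Sum>i<n. max 0 (\<nu> (B \<inter> A i)))"
          by (intro ennreal_leI sum_mono) auto
        also have "\<dots> = (\<Sum>i<n. ennreal (max 0 (\<nu> (B \<inter> A i))))" by (subst sum_ennreal) auto
        also have "\<dots> \<le> (\<Sum>i<n. var (A i))"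
          using A B by (intro sum_mono) (auto simp: max_def ennreal_neg intro!: var_upper)
        also have "\<dots> \<le> (\<Sum>i. var (A i))" by (intro sum_le_suminf) auto
        finally show ?thesis .
      qed
      ultimately show "ennreal (\<nu> B) \<le> (\<Sum>i. var (A i))"
        by (intro LIMSEQ_le_const2) auto
    qed
  qed
qed

lemma emeasure_upper_variation:
  "A \<in> sets circle_algebra \<Longrightarrow> emeasure (upper_variation \<nu>) A = var A"
  using measure_space_var unfolding upper_variation_def measure_space_def var_def
  by (intro emeasure_measure_of_sigma) auto

lemma sets_upper_variation [simp]: "sets (upper_variation \<nu>) = sets circle_algebra"
  unfolding upper_variation_def
  using sets.space_closed[of circle_algebra] sets.sigma_sets_eq[of circle_algebra] by simp

lemma space_upper_variation [simp]: "space (upper_variation \<nu>) = sphere 0 1"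
  unfolding upper_variation_def using sets.space_closed[of circle_algebra] by simp

lemma finite_measure_upper_variation: "finite_measure (upper_variation \<nu>)"
proof
  obtain c where c: "\<And>B. B \<in> sets circle_algebra \<Longrightarrow> \<bar>\<nu> B\<bar> \<le> c" using bounded by blast
  have "var (sphere 0 1) \<le> ennreal c"
    by (intro var_least ennreal_leI) (use c in \<open>auto simp: abs_le_iff\<close>)
  then show "emeasure (upper_variation \<nu>) (space (upper_variation \<nu>)) \<noteq> \<infinity>"
    using sets.top[of circle_algebra] by (auto simp: emeasure_upper_variation top_unique)
qed

lemma real_charge_uminus: "real_charge (\<lambda>A. - \<nu> A)"
  by unfold_locales (auto simp: empty intro!: sums_minus sums)

lemma Jordan_decomposition:
  assumes A: "A \<in> sets circle_algebra"
  shows "\<nu> A = measure (upper_variation \<nu>) A - measure (upper_variation (\<lambda>A. - \<nu> A)) A"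
proof -
  interpret neg: real_charge "\<lambda>A. - \<nu> A" by (rule real_charge_uminus)
  interpret P: finite_measure "upper_variation \<nu>" by (rule finite_measure_upper_variation)
  interpret N: finite_measure "upper_variation (\<lambda>A. - \<nu> A)" by (rule neg.finite_measure_upper_variation)
  let ?p = "measure (upper_variation \<nu>) A" and ?n = "measure (upper_variation (\<lambda>A. - \<nu> A)) A"
  have p: "var A = ennreal ?p" and n: "neg.var A = ennreal ?n"
    using A P.emeasure_eq_measure N.emeasure_eq_measure
    by (simp_all flip: emeasure_upper_variation neg.emeasure_upper_variation)
  have up: "\<nu> B \<le> ?p" "- \<nu> B \<le> ?n" if "B \<in> sets circle_algebra" "B \<subseteq> A" for B
    using var_upper[OF that] neg.var_upper[OF that] by (simp_all add: p n ennreal_le_iff)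
  have "var A \<le> ennreal (?n + \<nu> A)"
    using A up(2)[of "A - _"] by (intro var_least ennreal_leI) (fastforce simp: diff)
  moreover have "neg.var A \<le> ennreal (?p - \<nu> A)"
    using A up(1)[of "A - _"] by (intro neg.var_least ennreal_leI) (fastforce simp: diff)
  ultimately show ?thesis
    using up[of A] up[of "{}"] A by (simp add: p n ennreal_le_iff)
qed

end

lemma complex_borel_measure_real_charge:
  assumes "complex_borel_measure \<mu>"
  shows "real_charge (\<lambda>A. Re (\<mu> A))" "real_charge (\<lambda>A. Im (\<mu> A))"
  using assms unfolding complex_borel_measure_def
  by (auto intro!: real_charge.intro sums_Re sums_Im)

lemma cm_integrable_bounded:
  assumes \<mu>: "complex_borel_measure \<mu>" and f: "f \<in> borel_measurable circle_algebra"
    and b: "\<And>u. u \<in> sphere 0 1 \<Longrightarrow> norm (f u) \<le> b"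
  shows "cm_integrable \<mu> f"
proof -
  have *: "integrable (upper_variation \<nu>) f" if "real_charge \<nu>" for \<nu>
  proof -
    interpret real_charge \<nu> by (rule that)
    interpret finite_measure "upper_variation \<nu>" by (rule finite_measure_upper_variation)
    have "f \<in> borel_measurable (upper_variation \<nu>)"
      using f by (simp cong: measurable_cong_sets)
    then show ?thesis using b by (intro integrable_const_bound[of _ b]) auto
  qed
  show ?thesis
    using complex_borel_measure_real_charge[OF \<mu>]
    by (auto simp: cm_integrable_def variation_parts_def intro!: * real_charge.real_charge_uminus)
qed

lemma cm_integral_cong:
  assumes "\<And>u. u \<in> sphere 0 1 \<Longrightarrow> f u = g u"
  shows "cm_integral \<mu> f = cm_integral \<mu> g"
proof -
  have "space (upper_variation \<nu>) = sphere 0 1" for \<nu>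
    unfolding upper_variation_def circle_algebra_def
    by (intro space_measure_of) (use sets.space_closed in \<open>force simp: space_restrict_space\<close>)
  then have "integral\<^sup>L (upper_variation \<nu>) f = integral\<^sup>L (upper_variation \<nu>) g" for \<nu>
    using assms by (intro Bochner_Integration.integral_cong) auto
  then show ?thesis by (simp add: cm_integral_def)
qed

text \<open>Below, a pair \<open>\<mu>\<close>, \<open>\<rho>\<close> stands for the measure \<open>\<rho>(u) d\<mu>(u)\<close>, so that its integral of \<open>f\<close> is
  \<^term>\<open>cm_integral \<mu> (\<lambda>u. f u * \<rho> u)\<close>. On the circle its moments all exist as soon as \<open>\<rho>\<close> itself is
  integrable, because \<open>\<bar>u\<^sup>k\<bar> = 1\<close>.\<close>

definition quasi_definite :: "(complex set \<Rightarrow> complex) \<Rightarrow> (complex \<Rightarrow> complex) \<Rightarrow> bool" where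
  "quasi_definite \<mu> \<rho> \<longleftrightarrow>
     (\<forall>n. det (mat (n + 1) (n + 1)
        (\<lambda>(i, j). cm_integral \<mu> (\<lambda>u. u powi (int i - int j) * \<rho> u))) \<noteq> 0)"


section \<open>Deformations and Miwa shifts\<close>

text \<open>Deformation parameters \<open>t a j\<close> are used for \<open>a \<in> {1, 2}\<close> and \<open>j \<ge> 1\<close> only.\<close>

definition deformation_converges :: "(nat \<Rightarrow> nat \<Rightarrow> complex) \<Rightarrow> bool" where
  "deformation_converges t \<longleftrightarrow>
     (\<forall>a \<in> {1, 2}. \<forall>u \<in> sphere 0 1. summable (\<lambda>j. t a (Suc j) * u ^ Suc j))"

definition deformation :: "(nat \<Rightarrow> nat \<Rightarrow> complex) \<Rightarrow> complex \<Rightarrow> complex" where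
  "deformation t u = exp (\<Sum>j. t 1 (Suc j) * u ^ Suc j - t 2 (Suc j) * inverse u ^ Suc j)"

text \<open>The densities of the deformed measure at \<open>t - [w]\<^sub>1\<close> and \<open>t + [w]\<^sub>2\<close>, for arbitrary \<open>w\<close>;
  the lemmas \<open>deformation_miwa_sub1\<close> and \<open>deformation_miwa_add2\<close> justify them for \<open>\<bar>w\<bar> < 1\<close>.\<close>

definition deformation_sub1 :: "(nat \<Rightarrow> nat \<Rightarrow> complex) \<Rightarrow> complex \<Rightarrow> complex \<Rightarrow> complex" where
  "deformation_sub1 t w u = (1 - w * u) * deformation t u"

definition deformation_add2 :: "(nat \<Rightarrow> nat \<Rightarrow> complex) \<Rightarrow> complex \<Rightarrow> complex \<Rightarrow> complex" where
  "deformation_add2 t w u = (1 - w / u) * deformation t u"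

definition miwa_sub1 :: "(nat \<Rightarrow> nat \<Rightarrow> complex) \<Rightarrow> complex \<Rightarrow> nat \<Rightarrow> nat \<Rightarrow> complex" where
  "miwa_sub1 t w = t(1 := \<lambda>j. t 1 j - w ^ j / of_nat j)"

definition miwa_add2 :: "(nat \<Rightarrow> nat \<Rightarrow> complex) \<Rightarrow> complex \<Rightarrow> nat \<Rightarrow> nat \<Rightarrow> complex" where
  "miwa_add2 t w = t(2 := \<lambda>j. t 2 j + w ^ j / of_nat j)"

lemma log_series_sums:
  fixes x :: complex
  assumes "norm x < 1"
  shows "(\<lambda>j. x ^ Suc j / of_nat (Suc j)) sums - Ln (1 - x)"
proof -
  have "(\<lambda>n. (-1) ^ Suc n / of_nat n * (- x) ^ n) sums Ln (1 + (- x))"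
    by (rule Ln_series) (use assms in simp)
  then have "(\<lambda>n. - ((-1) ^ Suc n / of_nat n * (- x) ^ n)) sums - Ln (1 - x)"
    by (intro sums_minus) simp
  also have "(\<lambda>n. - ((-1) ^ Suc n / of_nat n * (- x) ^ n)) = (\<lambda>n. x ^ n / of_nat n)"
    by (auto simp: fun_eq_iff power_minus[of x] simp flip: power_add)
  finally show ?thesis
    by (subst sums_Suc_iff) simp
qed

lemma
  assumes t: "deformation_converges t" and w: "norm w < 1" and u: "u \<in> sphere 0 1"
  shows deformation_miwa_sub1: "deformation (miwa_sub1 t w) u = deformation_sub1 t w u"
    and deformation_miwa_add2: "deformation (miwa_add2 t w) u = deformation_add2 t w u"
proof -
  have u0: "u \<noteq> 0" "norm u = 1" using u by auto
  have u': "inverse u \<in> sphere 0 1" using u0 by (simp add: norm_inverse)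
  define f where "f j = t 1 (Suc j) * u ^ Suc j - t 2 (Suc j) * inverse u ^ Suc j" for j
  have "summable f"
    using t u u' unfolding f_def deformation_converges_def by (intro summable_diff) auto
  then have f: "f sums suminf f" by (rule summable_sums)
  have w1: "norm (w * u) < 1" and w2: "norm (w / u) < 1"
    using w u0 by (simp_all add: norm_mult norm_divide)
  have ne: "1 - w * u \<noteq> 0" "1 - w / u \<noteq> 0" using w1 w2 by auto
  have "(\<lambda>j. f j - (w * u) ^ Suc j / of_nat (Suc j)) sums (suminf f - - Ln (1 - w * u))"
    by (intro sums_diff f log_series_sums w1)
  also have "(\<lambda>j. f j - (w * u) ^ Suc j / of_nat (Suc j)) =
      (\<lambda>j. miwa_sub1 t w 1 (Suc j) * u ^ Suc j - miwa_sub1 t w 2 (Suc j) * inverse u ^ Suc j)"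
    by (auto simp: fun_eq_iff f_def miwa_sub1_def field_simps power_mult_distrib)
  finally show "deformation (miwa_sub1 t w) u = deformation_sub1 t w u"
    unfolding deformation_def deformation_sub1_def f_def[symmetric]
    using ne by (simp add: sums_iff exp_add f_def)
  have "(\<lambda>j. f j - (w / u) ^ Suc j / of_nat (Suc j)) sums (suminf f - - Ln (1 - w / u))"
    by (intro sums_diff f log_series_sums w2)
  also have "(\<lambda>j. f j - (w / u) ^ Suc j / of_nat (Suc j)) =
      (\<lambda>j. miwa_add2 t w 1 (Suc j) * u ^ Suc j - miwa_add2 t w 2 (Suc j) * inverse u ^ Suc j)"
    by (auto simp: fun_eq_iff f_def miwa_add2_def divide_inverse power_mult_distrib algebra_simps)
  finally show "deformation (miwa_add2 t w) u = deformation_add2 t w u"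
    unfolding deformation_def deformation_add2_def f_def[symmetric]
    using ne by (simp add: sums_iff exp_add f_def)
qed

text \<open>Convergence on the circle alone does not bound the deformation, so its integrability is a
  separate assumption; it is automatic when the series converge in the whole plane.\<close>

lemma deformation_integrable:
  assumes \<mu>: "complex_borel_measure \<mu>"
    and t: "\<And>a u. a \<in> {1, 2} \<Longrightarrow> summable (\<lambda>j. t a (Suc j) * u ^ Suc j)"
  shows "cm_integrable \<mu> (deformation t)"
proof -
  define F where "F a u = (\<Sum>j. t a (Suc j) * u ^ j)" for a :: nat and u :: complex
  have smb: "summable (\<lambda>j. t a (Suc j) * u ^ j)" if "a \<in> {1, 2}" for a u
  proof (cases "u = 0")
    case True
    have "summable (\<lambda>j. t a (Suc j) * 0 ^ j)" by (rule sums_summable[OF powser_sums_zero])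
    then show ?thesis unfolding True .
  next
    case False
    then show ?thesis
      using t[OF that, of u] summable_mult_D[of u "\<lambda>j. t a (Suc j) * u ^ j"] by (simp add: mult_ac)
  qed
  have cont: "continuous_on A (F a)" if "a \<in> {1, 2}" for A a
  proof (intro continuous_at_imp_continuous_on ballI)
    fix u :: complex
    have "norm u < norm (of_real (norm u + 1) :: complex)" by (subst norm_of_real) simp
    then show "isCont (F a) u"
      unfolding F_def by (rule isCont_powser[where c = "\<lambda>j. t a (Suc j)", OF smb[OF that]])
  qed
  have eq: "deformation t u = exp (u * F 1 u - inverse u * F 2 (inverse u))" for u
  proof -
    have shift: "(\<lambda>j. t a (Suc j) * v ^ Suc j) sums (v * F a v)" if "a \<in> {1, 2}" for a v
    proof -
      have "(\<lambda>j. v * (t a (Suc j) * v ^ j)) sums (v * F a v)"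
        unfolding F_def by (rule sums_mult[OF summable_sums[OF smb[OF that]]])
      moreover have "v * (t a (Suc j) * v ^ j) = t a (Suc j) * v ^ Suc j" for j by simp
      ultimately show ?thesis by (simp only:)
    qed
    have "(\<lambda>j. t 1 (Suc j) * u ^ Suc j - t 2 (Suc j) * inverse u ^ Suc j)
        sums (u * F 1 u - inverse u * F 2 (inverse u))"
      by (rule sums_diff[OF shift shift]) simp_all
    then show ?thesis unfolding deformation_def
      by (intro arg_cong[of _ _ exp] sums_unique[symmetric])
  qed
  have c: "continuous_on (sphere 0 1) (deformation t)"
  proof -
    have inv: "continuous_on (sphere 0 1) (inverse :: complex \<Rightarrow> complex)"
      by (intro continuous_intros) auto
    have F2: "continuous_on (sphere 0 1) (\<lambda>u. F 2 (inverse u))"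
      by (rule continuous_on_compose2[OF _ inv subset_UNIV]) (simp add: cont)
    have F1: "continuous_on (sphere 0 1) (F 1)" by (simp add: cont)
    show ?thesis
      unfolding eq[abs_def]
      by (intro continuous_on_exp continuous_on_diff continuous_on_mult continuous_on_id inv F1 F2)
  qed
  have "compact (deformation t ` sphere 0 1)" by (intro compact_continuous_image c) simp
  then have "bounded (deformation t ` sphere 0 1)" by (rule compact_imp_bounded)
  then obtain b where b: "\<forall>x \<in> deformation t ` sphere 0 1. norm x \<le> b"
    unfolding bounded_iff by (elim exE)
  then show ?thesis
    using borel_measurable_continuous_on_restrict[OF c]
    by (intro cm_integrable_bounded[OF \<mu> _ bspec[OF b imageI]]) (simp_all add: circle_algebra_def)
qed


section \<open>The extended ordering of the Laurent monomials\<close>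

text \<open>The \<open>k\<close>-th block of length \<open>n\<^sub>+ + n\<^sub>-\<close> consists of \<open>z\<close> to the powers
  \<open>k n\<^sub>+, \<dots>, (k + 1) n\<^sub>+ - 1\<close> followed by \<open>-k n\<^sub>- - 1, \<dots>, -(k + 1) n\<^sub>-\<close>.\<close>

definition chi_exp :: "nat \<Rightarrow> nat \<Rightarrow> nat \<Rightarrow> int" where
  "chi_exp np nm l =
     (let k = l div (np + nm); r = l mod (np + nm)
      in if r < np then int (k * np + r) else - int (k * nm + (r - np) + 1))"

definition chi :: "nat \<Rightarrow> nat \<Rightarrow> nat \<Rightarrow> complex \<Rightarrow> complex" where
  "chi np nm l z = z powi chi_exp np nm l"

definition kind :: "nat \<Rightarrow> nat \<Rightarrow> nat \<Rightarrow> nat" where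
  "kind np nm l = (if chi_exp np nm l \<ge> 0 then 1 else 2)"

definition nu_plus :: "nat \<Rightarrow> nat \<Rightarrow> nat \<Rightarrow> nat" where
  "nu_plus np nm l = card {l'. l' \<le> l \<and> kind np nm l' = 1}"

definition nu_minus :: "nat \<Rightarrow> nat \<Rightarrow> nat \<Rightarrow> nat" where
  "nu_minus np nm l = card {l'. l' \<le> l \<and> kind np nm l' = 2}"

definition next_index :: "nat \<Rightarrow> nat \<Rightarrow> nat \<Rightarrow> nat \<Rightarrow> nat" where
  "next_index np nm a l = (LEAST l'. l \<le> l' \<and> kind np nm l' = a)"

definition prev_index :: "nat \<Rightarrow> nat \<Rightarrow> nat \<Rightarrow> nat \<Rightarrow> nat" where
  "prev_index np nm a l = (GREATEST l'. l' \<le> l \<and> kind np nm l' = a)"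


section \<open>Moment matrix, Gauss--Borel factorization, Laurent polynomials\<close>

text \<open>Semi-infinite matrices are functions of two indices; \<open>leading l G\<close> is \<open>G\<^sup>[\<^sup>l\<^sup>]\<close>.\<close>

type_synonym smat = "nat \<Rightarrow> nat \<Rightarrow> complex"

definition moment_matrix ::
  "nat \<Rightarrow> nat \<Rightarrow> (complex set \<Rightarrow> complex) \<Rightarrow> (complex \<Rightarrow> complex) \<Rightarrow> smat" where
  "moment_matrix np nm \<mu> \<rho> i j =
     cm_integral \<mu> (\<lambda>u. chi np nm i u * cnj (chi np nm j u) * \<rho> u)"

definition leading :: "nat \<Rightarrow> smat \<Rightarrow> complex mat" where
  "leading l G = mat l l (\<lambda>(i, j). G i j)"

definition lower_unitriangular :: "smat \<Rightarrow> bool" where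
  "lower_unitriangular L \<longleftrightarrow> (\<forall>i. L i i = 1) \<and> (\<forall>i j. i < j \<longrightarrow> L i j = 0)"

definition upper_triangular_smat :: "smat \<Rightarrow> bool" where
  "upper_triangular_smat U \<longleftrightarrow> (\<forall>i j. j < i \<longrightarrow> U i j = 0)"

text \<open>The product of semi-infinite matrices when the left factor is lower triangular.\<close>

definition lower_times :: "smat \<Rightarrow> smat \<Rightarrow> smat" where
  "lower_times L X i j = (\<Sum>k\<le>i. L i k * X k j)"

definition smat_one :: smat where
  "smat_one i j = (if i = j then 1 else 0)"

definition gauss_borel :: "smat \<Rightarrow> smat \<Rightarrow> smat \<Rightarrow> bool" where
  "gauss_borel G S\<^sub>1 S\<^sub>2 \<longleftrightarrow>
     lower_unitriangular S\<^sub>1 \<and> upper_triangular_smat S\<^sub>2 \<and>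
     (\<exists>L. lower_unitriangular L \<and> lower_times L S\<^sub>1 = smat_one \<and> lower_times S\<^sub>1 L = smat_one \<and>
          G = lower_times L S\<^sub>2)"

definition S1 :: "smat \<Rightarrow> smat" where
  "S1 G = (THE S\<^sub>1. \<exists>S\<^sub>2. gauss_borel G S\<^sub>1 S\<^sub>2)"

definition S2 :: "smat \<Rightarrow> smat" where
  "S2 G = (THE S\<^sub>2. \<exists>S\<^sub>1. gauss_borel G S\<^sub>1 S\<^sub>2)"

definition minv :: "complex mat \<Rightarrow> complex mat" where
  "minv A = the (mat_inverse A)"

definition chi_vec :: "nat \<Rightarrow> nat \<Rightarrow> nat \<Rightarrow> complex \<Rightarrow> complex vec" where
  "chi_vec np nm l z = vec l (\<lambda>j. chi np nm j z)"

definition phi1 ::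
  "nat \<Rightarrow> nat \<Rightarrow> (complex set \<Rightarrow> complex) \<Rightarrow> (complex \<Rightarrow> complex) \<Rightarrow> nat \<Rightarrow> complex \<Rightarrow> complex" where
  "phi1 np nm \<mu> \<rho> l z = (\<Sum>k\<le>l. S1 (moment_matrix np nm \<mu> \<rho>) l k * chi np nm k z)"

definition phi1_plus ::
  "nat \<Rightarrow> nat \<Rightarrow> (complex set \<Rightarrow> complex) \<Rightarrow> (complex \<Rightarrow> complex) \<Rightarrow> nat \<Rightarrow> nat \<Rightarrow> complex \<Rightarrow> complex"
where
  "phi1_plus np nm \<mu> \<rho> a l z =
     (let G = moment_matrix np nm \<mu> \<rho>; m = next_index np nm a l
      in chi np nm m z
         - scalar_prod (vec l (\<lambda>j. G m j)) (minv (leading l G) *\<^sub>v chi_vec np nm l z))"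

definition phi1_minus ::
  "nat \<Rightarrow> nat \<Rightarrow> (complex set \<Rightarrow> complex) \<Rightarrow> (complex \<Rightarrow> complex) \<Rightarrow> nat \<Rightarrow> nat \<Rightarrow> complex \<Rightarrow> complex"
where
  "phi1_minus np nm \<mu> \<rho> a l z =
     (let G = moment_matrix np nm \<mu> \<rho>
      in scalar_prod (unit_vec (l + 1) (prev_index np nm a l))
           (minv (leading (l + 1) G) *\<^sub>v chi_vec np nm (l + 1) z))"

definition tau ::
  "nat \<Rightarrow> nat \<Rightarrow> (complex set \<Rightarrow> complex) \<Rightarrow> (complex \<Rightarrow> complex) \<Rightarrow> nat \<Rightarrow> complex" where
  "tau np nm \<mu> \<rho> l = det (leading l (moment_matrix np nm \<mu> \<rho>))"

definition tau_minus ::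
  "nat \<Rightarrow> nat \<Rightarrow> (complex set \<Rightarrow> complex) \<Rightarrow> (complex \<Rightarrow> complex) \<Rightarrow> nat \<Rightarrow> nat \<Rightarrow> complex" where
  "tau_minus np nm \<mu> \<rho> a l =
     (let m = prev_index np nm a l
      in (-1) ^ (l + m) * det (mat_delete (leading (l + 1) (moment_matrix np nm \<mu> \<rho>)) l m))"

lemma moment_matrix_miwa:
  assumes "deformation_converges t" "norm w < 1"
  shows "moment_matrix np nm \<mu> (deformation (miwa_sub1 t w)) = moment_matrix np nm \<mu> (deformation_sub1 t w)"
    and "moment_matrix np nm \<mu> (deformation (miwa_add2 t w)) = moment_matrix np nm \<mu> (deformation_add2 t w)"
  unfolding moment_matrix_def
  by (intro ext cm_integral_cong; simp add: deformation_miwa_sub1 deformation_miwa_add2 assms)+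

end

theory Submission
  imports Defs
begin

text \<open>
  On the circle the moment matrix is \<open>g\<^sub>i\<^sub>j = c (e\<^sub>i - e\<^sub>j)\<close>, where \<open>c\<close> is the moment sequence and
  \<open>e\<^sub>i\<close> the exponent of \<open>\<chi>\<^sup>(\<^sup>i\<^sup>)\<close>. The first \<open>l\<close> exponents fill an interval \<open>{-q, \<dots>, p - 1}\<close>, and
  the next monomial of either kind extends it by one step: \<open>p\<close> for a non-negative power, \<open>-q - 1\<close>
  for a negative one (\<open>bij_betw_chi_exp\<close>, \<open>chi_exp_eq_count\<close>). So every leading block is a Toeplitz
  matrix up to the same permutation of rows and columns, and quasi-definiteness makes all
  \<open>\<tau>\<^sup>(\<^sup>l\<^sup>)(t)\<close> non-zero.

  All the polynomials are quotients of determinants. A \<open>+\<close> polynomial, and in particular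
  \<open>\<phi>\<^sub>1\<^sup>(\<^sup>l\<^sup>)\<close>, is a Schur complement: the determinant of the leading block bordered by a column of
  powers of \<open>z\<close> and a row of moments, divided by \<open>\<tau>\<^sup>(\<^sup>l\<^sup>)\<close>. A \<open>-\<close> polynomial is, by Cramer's rule, the
  determinant of the block of size \<open>l + 1\<close> with one column replaced by the powers of \<open>z\<close>, divided by
  \<open>\<tau>\<^sup>(\<^sup>l\<^sup>+\<^sup>1\<^sup>)\<close>. For \<open>a = a(l)\<close> the two numerators coincide, and \<open>(S\<^sub>2)\<^sub>l\<^sub>l\<close> is the ratio of the two
  denominators.

  Every numerator thus has one column of powers of \<open>z\<close> among columns of moments, with \<open>l + 1\<close> consecutive
  exponents as row labels. If the last row carries the largest exponent, subtract from each other
  row \<open>z\<^sup>-\<^sup>1\<close> times the row whose exponent is larger by one (\<open>det_power_column_top\<close>). The column of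
  powers survives in the last row only, and above that row each moment \<open>c k\<close> turns into
  \<open>c k - z\<^sup>-\<^sup>1 c (k + 1)\<close>, which is the moment of the measure multiplied by \<open>1 - z\<^sup>-\<^sup>1 u\<close>. Expanding along
  the column gives the last power of \<open>z\<close> times the minor that defines the \<open>\<tau>\<close>-function at
  \<open>t - [z\<^sup>-\<^sup>1]\<^sub>1\<close>. If the last row carries the smallest exponent, the same argument with \<open>z\<close> and the
  row below yields the factor \<open>1 - z / u\<close>, that is \<open>t + [z]\<^sub>2\<close> (\<open>det_power_column_bottom\<close>).
\<close>

section \<open>Determinants indexed by integer labels\<close>

text \<open>Rows and columns are permuted simultaneously, so the sign of the permutation appears squared.\<close>

lemma det_reindex:
  fixes e :: "nat \<Rightarrow> int" and f :: "int \<Rightarrow> int \<Rightarrow> 'a :: comm_ring_1"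
  assumes e: "bij_betw e {0..<n} {k..<k + int n}"
  shows "det (mat n n (\<lambda>(i, j). f (e i) (e j))) = det (mat n n (\<lambda>(i, j). f (k + int i) (k + int j)))"
proof -
  define p where "p i = (if i < n then nat (e i - k) else i)" for i
  have bound: "k \<le> e i \<and> e i < k + int n" if "i < n" for i
    using bij_betwE[OF e] that by auto
  have inj: "inj_on p {0..<n}"
  proof (rule inj_onI)
    fix i j assume ij: "i \<in> {0..<n}" "j \<in> {0..<n}" "p i = p j"
    then have "e i = e j" using bound[of i] bound[of j] by (auto simp: p_def)
    then show "i = j" using ij bij_betw_imp_inj_on[OF e] by (auto dest: inj_onD)
  qed
  have "p ` {0..<n} \<subseteq> {0..<n}" using bound by (fastforce simp: p_def)
  then have "p ` {0..<n} = {0..<n}" using inj by (intro endo_inj_surj) auto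
  then have p: "p permutes {0..<n}"
    using inj by (intro bij_imp_permutes) (auto simp: bij_betw_def p_def)
  have pn: "p i < n" "k + int (p i) = e i" if "i < n" for i
    using bound[OF that] that by (auto simp: p_def)
  let ?A = "mat n n (\<lambda>(i, j). f (k + int i) (k + int j))"
  let ?C = "mat n n (\<lambda>(i, j). transpose_mat ?A $$ (p i, j))"
  have C: "det ?C = signof p * det ?A"
    by (subst det_permute_rows[OF _ p]) (simp_all add: det_transpose[of _ n])
  let ?M = "mat n n (\<lambda>(i, j). transpose_mat ?C $$ (p i, j))"
  have "det ?M = signof p * det ?C"
    by (subst det_permute_rows[OF _ p]) (simp_all add: det_transpose[of _ n])
  also have "\<dots> = det ?A"
    using sign_idempotent[of p]
    by (simp add: C mult.assoc[symmetric] flip: of_int_mult)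
  also have "?M = mat n n (\<lambda>(i, j). f (e i) (e j))"
    by (rule eq_matI) (auto simp: pn)
  finally show ?thesis .
qed

lemma mat_delete_cong:
  assumes "\<And>i j. i < n \<Longrightarrow> j < n \<Longrightarrow> i \<noteq> r \<Longrightarrow> j \<noteq> s \<Longrightarrow> f (i, j) = g (i, j)"
  shows "mat_delete (mat n n f) r s = mat_delete (mat n n g) r s"
  unfolding mat_delete_def by (rule eq_matI) (use assms in auto)

text \<open>The rows are combined with their neighbours until the column \<open>m\<close> is zero outside the row \<open>l\<close>,
  and the determinant is expanded along that column.
  The matrix \<open>F (e i) j - w * F (e i + 1) j\<close> differs in the row \<open>l\<close> from the result of the row
  operations, but this row is deleted. Here \<open>F\<close> takes a label rather than a row number, so that
  the neighbour of a row can be named without inverting the enumeration \<open>e\<close>.\<close>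

lemma det_shift_rows:
  fixes e :: "nat \<Rightarrow> int" and F :: "int \<Rightarrow> nat \<Rightarrow> 'a :: comm_ring_1"
  assumes e: "bij_betw e {0..<Suc l} {k..<k + int (Suc l)}" and top: "e l = k + int l"
    and m: "m \<le> l"
    and F: "\<And>a. k \<le> a \<Longrightarrow> a < k + int l \<Longrightarrow> F a m = w * F (a + 1) m"
  shows "det (mat (Suc l) (Suc l) (\<lambda>(i, j). F (e i) j)) =
    F (e l) m * ((-1) ^ (l + m) *
      det (mat_delete (mat (Suc l) (Suc l) (\<lambda>(i, j). F (e i) j - w * F (e i + 1) j)) l m))"
proof -
  define u :: "int \<Rightarrow> int \<Rightarrow> 'a"
    where "u a b = (if b = a then 1 else if b = a + 1 then - w else 0)" for a b
  let ?A = "mat (Suc l) (Suc l) (\<lambda>(i, j). F (e i) j)"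
  let ?U = "mat (Suc l) (Suc l) (\<lambda>(i, j). u (e i) (e j))"
  let ?I = "{k..<k + int (Suc l)}"
  \<comment> \<open>The row operations are multiplication by \<open>?U\<close>; sorted by labels, it is unitriangular.\<close>
  have "det ?U = det (mat (Suc l) (Suc l) (\<lambda>(i, j). u (k + int i) (k + int j)))"
    by (rule det_reindex[OF e])
  also have "\<dots> = 1"
    by (subst det_upper_triangular[of _ "Suc l"])
      (auto simp: u_def upper_triangular_def prod_list_diag_prod)
  finally have U: "det ?U = 1" .
  have bound: "k \<le> e i \<and> e i < k + int l" if "i < l" for i
  proof -
    have "e i \<in> ?I" using bij_betwE[OF e] that by auto
    moreover have "e i \<noteq> e l"
      using inj_onD[OF bij_betw_imp_inj_on[OF e], of i l] that by auto
    ultimately show ?thesis using top by auto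
  qed
  define W where "W = ?U * ?A"
  have W: "W \<in> carrier_mat (Suc l) (Suc l)"
    unfolding W_def by (rule mult_carrier_mat[of _ _ "Suc l"]) auto
  have entry: "W $$ (i, j) = F (e i) j - (if i < l then w * F (e i + 1) j else 0)"
    if "i < Suc l" "j < Suc l" for i j
  proof -
    have "W $$ (i, j) = (\<Sum>h\<in>{0..<Suc l}. u (e i) (e h) * F (e h) j)"
      using that by (simp add: W_def scalar_prod_def)
    also have "\<dots> = (\<Sum>b\<in>?I. u (e i) b * F b j)"
      using sum.reindex_bij_betw[OF e, of "\<lambda>b. u (e i) b * F b j"] .
    also have "\<dots> = (\<Sum>b\<in>?I. (if b = e i then F b j else 0) + (if b = e i + 1 then - w * F b j else 0))"
      by (rule sum.cong) (auto simp: u_def)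
    also have "\<dots> = F (e i) j - (if i < l then w * F (e i + 1) j else 0)"
      using bound[of i] top that less_Suc_eq[of i l] by (auto simp: sum.distrib sum.delta)
    finally show ?thesis .
  qed
  have "det ?A = det W" unfolding W_def by (subst det_mult[of _ "Suc l"]) (simp_all add: U)
  also have "\<dots> = (\<Sum>i<Suc l. W $$ (i, m) * cofactor W i m)"
    using m by (intro laplace_expansion_column[OF W]) auto
  also have "\<dots> = (\<Sum>i<Suc l. if i = l then F (e l) m * cofactor W l m else 0)"
  proof (rule sum.cong)
    fix i assume "i \<in> {..<Suc l}"
    then show "W $$ (i, m) * cofactor W i m = (if i = l then F (e l) m * cofactor W l m else 0)"
      using entry[of i m] m bound[of i] F[of "e i"] by (cases "i = l") auto
  qed simp
  also have "\<dots> = F (e l) m * cofactor W l m" by simp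
  also have "W = mat (Suc l) (Suc l) (\<lambda>(i, j). W $$ (i, j))" using W by auto
  also have "cofactor \<dots> l m = (-1) ^ (l + m) *
      det (mat_delete (mat (Suc l) (Suc l) (\<lambda>(i, j). F (e i) j - w * F (e i + 1) j)) l m)"
    unfolding cofactor_def
    by (intro arg_cong2[of _ _ _ _ "(*)"] arg_cong[of _ _ det] mat_delete_cong refl)
      (use entry in \<open>simp add: less_Suc_eq\<close>)
  finally show ?thesis .
qed

lemma bij_betw_Suc_interval:
  assumes "bij_betw e {0..<l} {k..<k + int l}" "e l = k + int l"
  shows "bij_betw e {0..<Suc l} {k..<k + int (Suc l)}"
proof -
  have "bij_betw e ({0..<l} \<union> {l}) ({k..<k + int l} \<union> {k + int l})"
    by (rule bij_betw_combine) (use assms in \<open>auto simp: bij_betw_def\<close>)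
  moreover have "{0..<l} \<union> {l} = {0..<Suc l}" "{k..<k + int l} \<union> {k + int l} = {k..<k + int (Suc l)}"
    by auto
  ultimately show ?thesis by simp
qed

text \<open>In the column \<open>m\<close> each entry \<open>z\<^sup>a\<close> is \<open>z\<^sup>-\<^sup>1\<close> times the entry \<open>z\<^sup>a\<^sup>+\<^sup>1\<close> of the row labelled \<open>a + 1\<close>,
  so the row operations clear this column except in the row \<open>l\<close> with the largest label.\<close>

lemma det_power_column_top:
  fixes c :: "int \<Rightarrow> 'a :: field"
  assumes e: "bij_betw e {0..<l} {k..<k + int l}" "e l = k + int l" and m: "m \<le> l" and z: "z \<noteq> 0"
  shows "det (mat (Suc l) (Suc l) (\<lambda>(i, j). if j = m then z powi e i else c (e i - e j))) =
    z powi e l * ((-1) ^ (l + m) * det (mat_delete (mat (Suc l) (Suc l)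
      (\<lambda>(i, j). c (e i - e j) - inverse z * c (e i - e j + 1))) l m))"
proof -
  let ?F = "\<lambda>a j. if j = m then z powi a else c (a - e j)"
  have "det (mat (Suc l) (Suc l) (\<lambda>(i, j). ?F (e i) j)) = ?F (e l) m * ((-1) ^ (l + m) *
      det (mat_delete (mat (Suc l) (Suc l) (\<lambda>(i, j). ?F (e i) j - inverse z * ?F (e i + 1) j)) l m))"
    by (rule det_shift_rows[OF bij_betw_Suc_interval[OF e] e(2) m])
      (use z in \<open>simp add: power_int_add_1\<close>)
  also have "mat_delete (mat (Suc l) (Suc l) (\<lambda>(i, j). ?F (e i) j - inverse z * ?F (e i + 1) j)) l m =
      mat_delete (mat (Suc l) (Suc l) (\<lambda>(i, j). c (e i - e j) - inverse z * c (e i - e j + 1))) l m"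
    by (rule mat_delete_cong) (simp add: algebra_simps)
  finally show ?thesis by simp
qed

text \<open>The reflection \<open>e \<mapsto> -e\<close>, \<open>z \<mapsto> z\<^sup>-\<^sup>1\<close> turns the smallest label into the largest.\<close>

lemma det_power_column_bottom:
  fixes c :: "int \<Rightarrow> 'a :: field"
  assumes e: "bij_betw e {0..<l} {k<..k + int l}" "e l = k" and m: "m \<le> l" and z: "z \<noteq> 0"
  shows "det (mat (Suc l) (Suc l) (\<lambda>(i, j). if j = m then z powi e i else c (e i - e j))) =
    z powi e l * ((-1) ^ (l + m) * det (mat_delete (mat (Suc l) (Suc l)
      (\<lambda>(i, j). c (e i - e j) - z * c (e i - e j - 1))) l m))"
proof -
  have "bij_betw uminus {k<..k + int l} {- (k + int l)..<- (k + int l) + int l}"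
    by (rule bij_betw_byWitness[where f' = uminus]) auto
  from bij_betw_trans[OF e(1) this] have "bij_betw (\<lambda>i. - e i) {0..<l} {- (k + int l)..<- (k + int l) + int l}"
    by (simp add: comp_def)
  note top = det_power_column_top[OF this _ m, of "inverse z" "\<lambda>a. c (- a)"]
  have "inverse z powi - a = z powi a" for a
    by (simp add: power_int_inverse power_int_minus)
  then have "(\<lambda>(i, j). if j = m then inverse z powi - e i else c (- (- e i - - e j))) =
      (\<lambda>(i, j). if j = m then z powi e i else c (e i - e j))"
    "inverse z powi - e l = z powi e l"
    by (auto simp: fun_eq_iff)
  with top show ?thesis using z e(2) by (simp add: algebra_simps)
qed

text \<open>Adding a combination of the other rows to the last one clears it up to the corner, which then
  is a factor of the determinant.\<close>

lemma det_last_row: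
  fixes X :: "nat \<Rightarrow> nat \<Rightarrow> 'a :: comm_ring_1"
  assumes s: "\<And>j. j < l \<Longrightarrow> X l j + (\<Sum>k<l. s k * X k j) = 0"
  shows "det (mat (Suc l) (Suc l) (\<lambda>(i, j). X i j)) =
    (X l l + (\<Sum>k<l. s k * X k l)) * det (mat l l (\<lambda>(i, j). X i j))"
proof -
  let ?X = "mat (Suc l) (Suc l) (\<lambda>(i, j). X i j)"
  define r where "r i k = (if i = k then 1 else if i = l then s k else 0)" for i k
  let ?R = "mat (Suc l) (Suc l) (\<lambda>(i, k). r i k)"
  have R: "det ?R = 1"
    by (subst det_lower_triangular[of "Suc l"]) (auto simp: r_def prod_list_diag_prod)
  define W where "W = ?R * ?X"
  have W: "W \<in> carrier_mat (Suc l) (Suc l)"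
    unfolding W_def by (rule mult_carrier_mat[of _ _ "Suc l"]) auto
  have entry: "W $$ (i, j) = (if i = l then X l j + (\<Sum>k<l. s k * X k j) else X i j)"
    if "i < Suc l" "j < Suc l" for i j
  proof -
    have "W $$ (i, j) = (\<Sum>k<Suc l. r i k * X k j)"
      using that by (simp add: W_def scalar_prod_def lessThan_atLeast0)
    also have "\<dots> = (if i = l then X l j + (\<Sum>k<l. s k * X k j) else X i j)"
    proof (cases "i = l")
      case True
      have "(\<Sum>k<l. r l k * X k j) = (\<Sum>k<l. s k * X k j)"
        by (rule sum.cong) (auto simp: r_def)
      then show ?thesis using True by (simp add: r_def)
    next
      case False
      have "(\<Sum>k<Suc l. r i k * X k j) = (\<Sum>k<Suc l. if k = i then X k j else 0)"
        using False by (intro sum.cong) (auto simp: r_def)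
      also have "\<dots> = X i j" using that by (subst sum.delta) auto
      finally show ?thesis using False by simp
    qed
    finally show ?thesis .
  qed
  have "det ?X = det W" unfolding W_def by (subst det_mult[of _ "Suc l"]) (simp_all add: R)
  also have "\<dots> = (\<Sum>j<Suc l. W $$ (l, j) * cofactor W l j)"
    by (intro laplace_expansion_row[OF W]) auto
  also have "\<dots> = (X l l + (\<Sum>k<l. s k * X k l)) * cofactor W l l"
    by (simp add: entry s)
  also have "cofactor W l l = det (mat l l (\<lambda>(i, j). X i j))"
  proof -
    have "mat_delete W l l = mat l l (\<lambda>(i, j). X i j)"
      by (rule eq_matI) (use W in \<open>auto simp: mat_delete_def entry\<close>)
    then show ?thesis by (simp add: cofactor_def)
  qed
  finally show ?thesis .
qed

section \<open>Bordered determinants and the Gauss--Borel factorization\<close>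

lemma minv_inverse:
  assumes A: "A \<in> carrier_mat n n" and det: "det A \<noteq> 0"
  shows "A * minv A = 1\<^sub>m n" "minv A * A = 1\<^sub>m n" "minv A \<in> carrier_mat n n"
proof -
  have "mat_inverse A \<noteq> None"
    using mat_inverse(1)[OF A, of undefined] det_non_zero_imp_unit[OF A det, of undefined] by blast
  then obtain B where "mat_inverse A = Some B" by blast
  then show "A * minv A = 1\<^sub>m n" "minv A * A = 1\<^sub>m n" "minv A \<in> carrier_mat n n"
    using mat_inverse(2)[OF A] by (auto simp: minv_def)
qed

lemma leading_carrier [simp]: "leading l G \<in> carrier_mat l l"
  by (simp add: leading_def)

text \<open>The coefficients that make row \<open>m\<close> of \<open>G\<close>, corrected by the first \<open>l\<close> rows, vanish in the first
  \<open>l\<close> columns. If the block is non-singular, they are unique, and for \<open>m = l\<close> they are the part left of the diagonal in row \<open>l\<close> of \<open>S\<^sub>1\<close>.\<close>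

definition annihilating_row :: "smat \<Rightarrow> nat \<Rightarrow> nat \<Rightarrow> nat \<Rightarrow> complex" where
  "annihilating_row G l m k = - (\<Sum>j<l. G m j * minv (leading l G) $$ (j, k))"

lemma minv_leading_entries:
  assumes det: "det (leading l G) \<noteq> 0" and ij: "i < l" "j < l"
  shows "(\<Sum>k<l. G i k * minv (leading l G) $$ (k, j)) = (if i = j then 1 else 0)"
    and "(\<Sum>k<l. minv (leading l G) $$ (i, k) * G k j) = (if i = j then 1 else 0)"
proof -
  note inv = minv_inverse[OF leading_carrier det]
  have "(leading l G * minv (leading l G)) $$ (i, j) = (\<Sum>k<l. G i k * minv (leading l G) $$ (k, j))"
    using ij inv(3) by (auto simp: scalar_prod_def leading_def lessThan_atLeast0)
  then show "(\<Sum>k<l. G i k * minv (leading l G) $$ (k, j)) = (if i = j then 1 else 0)"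
    using ij by (simp add: inv(1))
  have "(minv (leading l G) * leading l G) $$ (i, j) = (\<Sum>k<l. minv (leading l G) $$ (i, k) * G k j)"
    using ij inv(3) by (auto simp: scalar_prod_def leading_def lessThan_atLeast0)
  then show "(\<Sum>k<l. minv (leading l G) $$ (i, k) * G k j) = (if i = j then 1 else 0)"
    using ij by (simp add: inv(2))
qed

lemma annihilating_row_annihilates:
  assumes det: "det (leading l G) \<noteq> 0" and j: "j < l"
  shows "G m j + (\<Sum>k<l. annihilating_row G l m k * G k j) = 0"
proof -
  have "(\<Sum>k<l. annihilating_row G l m k * G k j) =
      - (\<Sum>k<l. \<Sum>i<l. G m i * (minv (leading l G) $$ (i, k) * G k j))"
    by (simp add: annihilating_row_def sum_distrib_right sum_negf mult.assoc)
  also have "\<dots> = - (\<Sum>i<l. G m i * (\<Sum>k<l. minv (leading l G) $$ (i, k) * G k j))"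
    by (subst sum.swap) (simp add: sum_distrib_left)
  also have "\<dots> = - (\<Sum>i<l. if i = j then G m i else 0)"
    by (intro arg_cong[of _ _ uminus] sum.cong) (simp_all add: minv_leading_entries(2)[OF det _ j])
  also have "\<dots> = - G m j" using j by simp
  finally show ?thesis by simp
qed

lemma annihilating_row_unique:
  assumes det: "det (leading l G) \<noteq> 0"
    and s: "\<And>j. j < l \<Longrightarrow> G m j + (\<Sum>k<l. s k * G k j) = 0" and k: "k < l"
  shows "s k = annihilating_row G l m k"
proof -
  let ?B = "minv (leading l G)"
  have G: "G m j = - (\<Sum>i<l. s i * G i j)" if "j < l" for j
    using s[OF that] by (simp add: eq_neg_iff_add_eq_0)
  have "annihilating_row G l m k = (\<Sum>j<l. \<Sum>i<l. s i * (G i j * ?B $$ (j, k)))"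
    by (simp add: annihilating_row_def G sum_distrib_right sum_negf mult.assoc)
  also have "\<dots> = (\<Sum>i<l. s i * (\<Sum>j<l. G i j * ?B $$ (j, k)))"
    by (subst sum.swap) (simp add: sum_distrib_left)
  also have "\<dots> = (\<Sum>i<l. if i = k then s i else 0)"
    by (intro sum.cong) (simp_all add: minv_leading_entries(1)[OF det _ k])
  also have "\<dots> = s k" using k by simp
  finally show ?thesis by simp
qed

text \<open>Row \<open>m\<close> of \<open>G\<close> comes below the leading block and the column \<open>x\<close> to its right; the corner
  entry is \<open>x m\<close>.\<close>

definition bordered :: "smat \<Rightarrow> nat \<Rightarrow> nat \<Rightarrow> (nat \<Rightarrow> complex) \<Rightarrow> complex" where
  "bordered G l m x = det (mat (Suc l) (Suc l)
     (\<lambda>(i, j). let r = (if i < l then i else m) in if j = l then x r else G r j))"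

lemma bordered_eq:
  assumes s: "\<And>j. j < l \<Longrightarrow> G m j + (\<Sum>k<l. s k * G k j) = 0"
  shows "bordered G l m x = (x m + (\<Sum>k<l. s k * x k)) * det (leading l G)"
proof -
  define r where "r i = (if i < l then i else m)" for i
  define X where "X i j = (if j = l then x (r i) else G (r i) j)" for i j
  have "bordered G l m x = det (mat (Suc l) (Suc l) (\<lambda>(i, j). X i j))"
    unfolding bordered_def X_def r_def Let_def ..
  also have "\<dots> = (X l l + (\<Sum>k<l. s k * X k l)) * det (mat l l (\<lambda>(i, j). X i j))"
    by (rule det_last_row) (use s in \<open>simp add: X_def r_def\<close>)
  also have "mat l l (\<lambda>(i, j). X i j) = leading l G"
    unfolding leading_def by (rule eq_matI) (auto simp: X_def r_def)
  finally show ?thesis by (simp add: X_def r_def)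
qed

lemma lower_times_assoc:
  assumes "lower_unitriangular S"
  shows "lower_times L (lower_times S X) = lower_times (lower_times L S) X"
proof (intro ext)
  fix i j
  have "lower_times L (lower_times S X) i j = (\<Sum>k\<le>i. L i k * (\<Sum>h\<le>i. S k h * X h j))"
    unfolding lower_times_def
    by (intro sum.cong refl arg_cong2[of _ _ _ _ "(*)"] sum.mono_neutral_left)
      (use assms in \<open>auto simp: lower_unitriangular_def\<close>)
  also have "\<dots> = (\<Sum>h\<le>i. \<Sum>k\<le>i. L i k * S k h * X h j)"
    by (subst sum.swap) (simp add: sum_distrib_left mult.assoc)
  also have "\<dots> = lower_times (lower_times L S) X i j"
    by (simp add: lower_times_def sum_distrib_right)
  finally show "lower_times L (lower_times S X) i j = lower_times (lower_times L S) X i j" .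
qed

lemma lower_times_one_left [simp]: "lower_times smat_one X = X"
  by (intro ext) (simp add: lower_times_def smat_one_def if_distrib if_distribR cong: if_cong)

lemma lower_times_one_right:
  assumes "lower_unitriangular L"
  shows "lower_times L smat_one = L"
  using assms
  by (intro ext) (auto simp: lower_times_def smat_one_def lower_unitriangular_def not_le
      if_distrib if_distribR cong: if_cong)

text \<open>Forward substitution. It solves \<open>S * X = 1\<close>; that the solution is a left inverse as well follows
  from associativity.\<close>

fun lower_inverse :: "smat \<Rightarrow> nat \<Rightarrow> nat \<Rightarrow> complex" where
  "lower_inverse S i = (\<lambda>j. smat_one i j - (\<Sum>k\<in>{..<i}. S i k * lower_inverse S k j))"

declare lower_inverse.simps [simp del]

lemma lower_inverse_right:
  assumes S: "lower_unitriangular S"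
  shows "lower_unitriangular (lower_inverse S)" "lower_times S (lower_inverse S) = smat_one"
proof -
  have zero: "i < j \<Longrightarrow> lower_inverse S i j = 0" for i j
  proof (induction i rule: less_induct)
    case (less i)
    then show ?case by (subst lower_inverse.simps) (simp add: smat_one_def)
  qed
  have "lower_inverse S i i = 1" for i
    by (subst lower_inverse.simps) (simp add: zero smat_one_def)
  with zero show "lower_unitriangular (lower_inverse S)" by (simp add: lower_unitriangular_def)
  show "lower_times S (lower_inverse S) = smat_one"
  proof (intro ext)
    fix i j
    have "lower_times S (lower_inverse S) i j =
        lower_inverse S i j + (\<Sum>k<i. S i k * lower_inverse S k j)"
      using S by (simp add: lower_times_def lower_unitriangular_def flip: lessThan_Suc_atMost)
    then show "lower_times S (lower_inverse S) i j = smat_one i j"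
      by (simp add: lower_inverse.simps[of S i])
  qed
qed

text \<open>A right inverse \<open>L\<close> of \<open>S\<close> has in turn a right inverse, which must equal \<open>S\<close>.\<close>

lemma lower_inverse_left:
  assumes S: "lower_unitriangular S"
  shows "lower_times (lower_inverse S) S = smat_one"
proof -
  let ?L = "lower_inverse S"
  note L = lower_inverse_right[OF S]
  note LL = lower_inverse_right[OF L(1)]
  have "S = lower_times S (lower_times ?L (lower_inverse ?L))"
    using S by (simp add: LL(2) lower_times_one_right)
  also have "\<dots> = lower_inverse ?L" by (simp add: lower_times_assoc[OF L(1)] L(2))
  finally show ?thesis using LL(2) by simp
qed

text \<open>The inverse of \<open>S\<close> always exists, so that a factorization is nothing but a lower unitriangular
  \<open>S\<close> for which \<open>S * G\<close> is upper triangular.\<close>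

lemma gauss_borel_iff:
  "gauss_borel G S T \<longleftrightarrow>
     lower_unitriangular S \<and> upper_triangular_smat T \<and> T = lower_times S G"
proof
  assume "gauss_borel G S T"
  then show "lower_unitriangular S \<and> upper_triangular_smat T \<and> T = lower_times S G"
    by (auto simp: gauss_borel_def lower_times_assoc)
next
  assume ST: "lower_unitriangular S \<and> upper_triangular_smat T \<and> T = lower_times S G"
  let ?L = "lower_inverse S"
  have "lower_unitriangular ?L" "lower_times ?L S = smat_one" "lower_times S ?L = smat_one"
    using ST lower_inverse_right lower_inverse_left by auto
  moreover from this have "G = lower_times ?L T" using ST by (simp add: lower_times_assoc)
  ultimately show "gauss_borel G S T" using ST unfolding gauss_borel_def by blast
qed

text \<open>Vanishing of \<open>S * G\<close> below the diagonal is one linear system for each row of \<open>S\<close>, whose matrix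
  is a leading block of \<open>G\<close>. Non-singular blocks hence give existence and uniqueness at once.\<close>

lemma gauss_borel_unique:
  assumes det: "\<And>l. det (leading l G) \<noteq> 0"
  shows "gauss_borel G S T \<longleftrightarrow>
    S = (\<lambda>i k. if k < i then annihilating_row G i i k else if k = i then 1 else 0) \<and>
    T = lower_times S G" (is "_ \<longleftrightarrow> S = ?S \<and> _")
proof -
  have row: "lower_times S G i j = G i j + (\<Sum>k<i. S i k * G k j)"
    if "lower_unitriangular S" for S i j
    using that by (simp add: lower_times_def lower_unitriangular_def flip: lessThan_Suc_atMost)
  show ?thesis
  proof
    assume gb: "gauss_borel G S T"
    then have S: "lower_unitriangular S" and T: "upper_triangular_smat T" "T = lower_times S G"
      by (auto simp: gauss_borel_iff)
    have "S i k = annihilating_row G i i k" if "k < i" for i k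
      by (rule annihilating_row_unique[OF det _ that])
        (use T S row in \<open>auto simp: upper_triangular_smat_def\<close>)
    then have "S = ?S" using S by (auto simp: fun_eq_iff lower_unitriangular_def)
    with T show "S = ?S \<and> T = lower_times S G" by blast
  next
    assume ST: "S = ?S \<and> T = lower_times S G"
    then have S: "lower_unitriangular S" by (simp add: lower_unitriangular_def)
    have "T i j = 0" if "j < i" for i j
      using ST row[OF S] annihilating_row_annihilates[OF det that] by simp
    then show "gauss_borel G S T" using ST S by (simp add: gauss_borel_iff upper_triangular_smat_def)
  qed
qed

lemma S1_S2_eq:
  assumes det: "\<And>l. det (leading l G) \<noteq> 0"
  shows "k < i \<Longrightarrow> S1 G i k = annihilating_row G i i k" "S1 G i i = 1"
    "S2 G i j = (\<Sum>k\<le>i. S1 G i k * G k j)"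
proof -
  have "\<exists>!S. \<exists>T. gauss_borel G S T" "\<exists>!T. \<exists>S. gauss_borel G S T"
    unfolding gauss_borel_unique[OF det] by auto
  from theI'[OF this(1)] theI'[OF this(2)] obtain T S
    where "gauss_borel G (S1 G) T" "gauss_borel G S (S2 G)"
    unfolding S1_def S2_def by blast
  then show "k < i \<Longrightarrow> S1 G i k = annihilating_row G i i k" "S1 G i i = 1"
    "S2 G i j = (\<Sum>k\<le>i. S1 G i k * G k j)"
    unfolding gauss_borel_unique[OF det] by (auto simp: lower_times_def)
qed

lemma S1_row_bordered:
  assumes det: "\<And>l. det (leading l G) \<noteq> 0"
  shows "(\<Sum>k\<le>l. S1 G l k * x k) = bordered G l l x / det (leading l G)"
proof -
  have "(\<Sum>k\<le>l. S1 G l k * x k) = x l + (\<Sum>k<l. annihilating_row G l l k * x k)"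
    by (simp add: S1_S2_eq[OF det] flip: lessThan_Suc_atMost)
  then show ?thesis
    using bordered_eq[of l G l "annihilating_row G l l" x] annihilating_row_annihilates[OF det] det
    by simp
qed

text \<open>For \<open>x\<close> the column \<open>l\<close> of \<open>G\<close>, the bordered matrix is the next leading block.\<close>

lemma S2_diagonal:
  assumes det: "\<And>l. det (leading l G) \<noteq> 0"
  shows "S2 G l l = det (leading (Suc l) G) / det (leading l G)"
proof -
  have "bordered G l l (\<lambda>i. G i l) = det (leading (Suc l) G)"
    unfolding bordered_def leading_def
    by (intro arg_cong[of _ _ det] eq_matI) (auto simp: less_Suc_eq)
  then show ?thesis by (simp add: S1_S2_eq(3)[OF det] S1_row_bordered[OF det])
qed

lemma schur_complement_bordered:
  assumes det: "det (leading l G) \<noteq> 0"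
  shows "x m - scalar_prod (vec l (\<lambda>j. G m j)) (minv (leading l G) *\<^sub>v vec l x) =
    bordered G l m x / det (leading l G)"
proof -
  let ?B = "minv (leading l G)"
  note B = minv_inverse(3)[OF leading_carrier det]
  have "scalar_prod (vec l (\<lambda>j. G m j)) (?B *\<^sub>v vec l x) =
      (\<Sum>j<l. \<Sum>k<l. G m j * (?B $$ (j, k) * x k))"
    using B by (auto simp: scalar_prod_def lessThan_atLeast0 sum_distrib_left)
  also have "\<dots> = - (\<Sum>k<l. annihilating_row G l m k * x k)"
    by (subst sum.swap) (simp add: annihilating_row_def sum_distrib_right sum_negf mult.assoc)
  finally show ?thesis
    using bordered_eq[of l G m "annihilating_row G l m" x] annihilating_row_annihilates[OF det] det
    by simp
qed

lemma minv_row_cramer: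
  assumes det: "det (leading n G) \<noteq> 0" and m: "m < n"
  shows "scalar_prod (unit_vec n m) (minv (leading n G) *\<^sub>v vec n x) =
    det (mat n n (\<lambda>(i, j). if j = m then x i else G i j)) / det (leading n G)"
proof -
  note inv = minv_inverse[OF leading_carrier det]
  let ?y = "minv (leading n G) *\<^sub>v vec n x"
  have y: "?y \<in> carrier_vec n" using inv(3) by simp
  have "leading n G *\<^sub>v ?y = vec n x"
    using inv by (subst assoc_mult_mat_vec[symmetric, of _ n n _ n]) auto
  then have "det (replace_col (leading n G) (vec n x) m) = ?y $ m * det (leading n G)"
    using cramer_lemma_mat[OF leading_carrier y m] by metis
  moreover have "replace_col (leading n G) (vec n x) m =
      mat n n (\<lambda>(i, j). if j = m then x i else G i j)"
    by (rule eq_matI) (auto simp: replace_col_def leading_def)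
  ultimately show ?thesis using m y det by (simp add: scalar_prod_left_unit)
qed

section \<open>The extended ordering enumerates intervals of exponents\<close>

definition kind_count :: "nat \<Rightarrow> nat \<Rightarrow> nat \<Rightarrow> nat \<Rightarrow> nat" where
  "kind_count np nm a l = card {l'. l' < l \<and> kind np nm l' = a}"

lemma kind_count_0 [simp]: "kind_count np nm a 0 = 0"
  by (simp add: kind_count_def)

lemma kind_count_Suc [simp]:
  "kind_count np nm a (Suc l) = kind_count np nm a l + (if kind np nm l = a then 1 else 0)"
proof -
  have "{l'. l' < Suc l \<and> kind np nm l' = a} =
      (if kind np nm l = a then {l} else {}) \<union> {l'. l' < l \<and> kind np nm l' = a}"
    by (auto simp: less_Suc_eq)
  then show ?thesis by (simp add: kind_count_def card_insert_if)
qed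

lemma kind_cases: "kind np nm l = 1 \<or> kind np nm l = 2"
  by (simp add: kind_def)

lemma kind_count_sum: "kind_count np nm 1 l + kind_count np nm 2 l = l"
  by (induction l) (use kind_cases in \<open>auto simp: kind_def split: if_splits\<close>)

lemma kind_iff_mod: "kind np nm l = 1 \<longleftrightarrow> l mod (np + nm) < np"
proof -
  have "- int (k * nm + r + 1) < 0" for k r by (simp del: of_nat_mult)
  then show ?thesis by (auto simp: kind_def chi_exp_def Let_def simp del: of_nat_add of_nat_mult)
qed

lemma nu_plus_eq: "nu_plus np nm l = kind_count np nm 1 (Suc l)"
  by (simp add: nu_plus_def kind_count_def less_Suc_eq_le)

lemma nu_minus_eq: "nu_minus np nm l = kind_count np nm 2 (Suc l)"
  by (simp add: nu_minus_def kind_count_def less_Suc_eq_le)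

lemma kind_count_closed:
  assumes "np + nm > 0"
  shows "kind_count np nm 1 l = l div (np + nm) * np + min (l mod (np + nm)) np"
    "kind_count np nm 2 l = l div (np + nm) * nm + (l mod (np + nm) - np)"
proof -
  let ?N = "np + nm"
  show 1: "kind_count np nm 1 l = l div ?N * np + min (l mod ?N) np"
  proof (induction l)
    case (Suc l)
    have r: "l mod ?N < ?N" using assms by simp
    show ?case
      using Suc r kind_iff_mod[of np nm l] by (auto simp: mod_Suc div_Suc min_def)
  qed simp
  have "l = l div ?N * np + l div ?N * nm + l mod ?N"
    by (metis add_mult_distrib2 div_mult_mod_eq)
  then show "kind_count np nm 2 l = l div ?N * nm + (l mod ?N - np)"
    using 1 kind_count_sum[of np nm l] by (auto simp: min_def split: if_splits)
qed

text \<open>Each new monomial extends the exponents used so far by one step, upwards or downwards.\<close>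

lemma chi_exp_eq_count:
  assumes "np + nm > 0"
  shows "kind np nm l = 1 \<Longrightarrow> chi_exp np nm l = int (kind_count np nm 1 l)"
    "kind np nm l = 2 \<Longrightarrow> chi_exp np nm l = - int (kind_count np nm 2 l) - 1"
  using kind_iff_mod[of np nm l] kind_count_closed[OF assms, of l]
  by (auto simp: chi_exp_def Let_def)

lemma chi_exp_eq_nu:
  assumes "np + nm > 0"
  shows "kind np nm l = 1 \<Longrightarrow> chi_exp np nm l = int (nu_plus np nm l) - 1"
    "kind np nm l = 2 \<Longrightarrow> chi_exp np nm l = - int (nu_minus np nm l)"
  by (simp_all add: chi_exp_eq_count[OF assms] nu_plus_eq nu_minus_eq)

lemma bij_betw_chi_exp:
  assumes "np + nm > 0"
  shows "bij_betw (chi_exp np nm) {0..<l}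
    {- int (kind_count np nm 2 l)..<int (kind_count np nm 1 l)}"
proof (induction l)
  case (Suc l)
  let ?p = "int (kind_count np nm 1 l)" and ?q = "int (kind_count np nm 2 l)"
  have dom: "{0..<Suc l} = insert l {0..<l}" by auto
  have "{- int (kind_count np nm 2 (Suc l))..<int (kind_count np nm 1 (Suc l))} =
        insert (chi_exp np nm l) {- ?q..<?p} \<and> chi_exp np nm l \<notin> {- ?q..<?p}"
  proof (cases "kind np nm l = 1")
    case True
    then show ?thesis by (auto simp: chi_exp_eq_count[OF assms])
  next
    case False
    then have "kind np nm l = 2" using kind_cases by blast
    then show ?thesis by (auto simp: chi_exp_eq_count[OF assms])
  qed
  then show ?case using Suc unfolding dom
    using notIn_Un_bij_betw[of l "{0..<l}" "chi_exp np nm" "{- ?q..<?p}"] by simp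
qed (simp add: bij_betw_def)

lemma exponent_interval:
  assumes "np + nm > 0"
  shows "bij_betw (chi_exp np nm) {0..<l}
    {- int (kind_count np nm 2 l)..<- int (kind_count np nm 2 l) + int l}"
proof -
  have "- int (kind_count np nm 2 l) + int l = int (kind_count np nm 1 l)"
    using kind_count_sum[of np nm l] by linarith
  then show ?thesis using bij_betw_chi_exp[OF assms, of l] by simp
qed

lemma kind_unbounded:
  assumes "np \<ge> 1" "nm \<ge> 1" "a \<in> {1, 2}"
  shows "\<exists>l'\<ge>l. kind np nm l' = a"
proof -
  let ?i = "l * (np + nm) + (if a = 1 then 0 else np)"
  have "?i mod (np + nm) = (if a = 1 then 0 else np)" using assms by simp
  then have "kind np nm ?i = a"
    using assms kind_iff_mod[of np nm ?i] kind_cases[of np nm ?i] by auto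
  moreover have "?i \<ge> l" using assms(1) by (simp add: trans_le_add1)
  ultimately show ?thesis by blast
qed

text \<open>The monomials skipped before the next one of kind \<open>a\<close> are of the other kind, so the exponent
  found there is still adjacent to those of the first \<open>l\<close> monomials.\<close>

lemma next_index:
  assumes "np \<ge> 1" "nm \<ge> 1" "a \<in> {1, 2}"
  shows "kind np nm (next_index np nm a l) = a"
    "kind_count np nm a (next_index np nm a l) = kind_count np nm a l"
proof -
  let ?m = "next_index np nm a l"
  obtain l' where "l \<le> l' \<and> kind np nm l' = a" using kind_unbounded[OF assms] by blast
  from LeastI[where P = "\<lambda>l'. l \<le> l' \<and> kind np nm l' = a", OF this]
  have m: "l \<le> ?m" "kind np nm ?m = a" by (auto simp: next_index_def)
  then show "kind np nm ?m = a" by blast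
  have "kind np nm l' \<noteq> a" if "l \<le> l'" "l' < ?m" for l'
    using that not_less_Least unfolding next_index_def by blast
  then have "{l'. l' < ?m \<and> kind np nm l' = a} = {l'. l' < l \<and> kind np nm l' = a}"
    using m by (auto simp: not_le[symmetric])
  then show "kind_count np nm a ?m = kind_count np nm a l" by (simp add: kind_count_def)
qed

lemma next_index_self: "kind np nm l = a \<Longrightarrow> next_index np nm a l = l"
  unfolding next_index_def by (rule Least_equality) auto

lemma prev_index_self: "kind np nm l = a \<Longrightarrow> prev_index np nm a l = l"
  unfolding prev_index_def by (rule Greatest_equality) auto

lemma prev_index_le:
  assumes "l' \<le> l" "kind np nm l' = a"
  shows "prev_index np nm a l \<le> l"
  unfolding prev_index_def
  using GreatestI_nat[where P = "\<lambda>l'. l' \<le> l \<and> kind np nm l' = a", of l' l] assms by blast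

section \<open>Moments of the deformed measure\<close>

definition moment :: "(complex set \<Rightarrow> complex) \<Rightarrow> (complex \<Rightarrow> complex) \<Rightarrow> int \<Rightarrow> complex" where
  "moment \<mu> \<rho> k = cm_integral \<mu> (\<lambda>u. u powi k * \<rho> u)"

lemma cnj_powi_circle: "u \<in> sphere 0 1 \<Longrightarrow> cnj (u powi k) = u powi (- k)"
  for u :: complex
proof -
  assume "u \<in> sphere 0 1"
  then have "u \<noteq> 0" "u * cnj u = 1" by (auto simp flip: complex_norm_square)
  then have "cnj u = inverse u" by (metis inverse_unique)
  then show ?thesis by (simp add: power_int_minus power_int_inverse)
qed

lemma moment_matrix_eq_moment:
  "moment_matrix np nm \<mu> \<rho> i j = moment \<mu> \<rho> (chi_exp np nm i - chi_exp np nm j)"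
  unfolding moment_matrix_def moment_def
proof (rule cm_integral_cong)
  fix u :: complex assume u: "u \<in> sphere 0 1"
  then have "u \<noteq> 0" by auto
  then show "chi np nm i u * cnj (chi np nm j u) * \<rho> u =
      u powi (chi_exp np nm i - chi_exp np nm j) * \<rho> u"
    using cnj_powi_circle[OF u] by (simp add: chi_def power_int_diff power_int_minus divide_inverse)
qed

text \<open>On the circle \<open>u\<^sup>k\<close> is measurable of modulus one, so \<open>\<rho>\<close> itself dominates the product.\<close>

lemma cm_integrable_power:
  assumes \<mu>: "complex_borel_measure \<mu>" and \<rho>: "cm_integrable \<mu> \<rho>"
  shows "cm_integrable \<mu> (\<lambda>u. u powi k * \<rho> u)"
  unfolding cm_integrable_def
proof
  fix M assume M: "M \<in> variation_parts \<mu>"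
  then obtain \<nu> where \<nu>: "real_charge \<nu>" "M = upper_variation \<nu>"
    using complex_borel_measure_real_charge[OF \<mu>] real_charge.real_charge_uminus
    by (auto simp: variation_parts_def)
  interpret real_charge \<nu> by (rule \<nu>(1))
  have int: "integrable M \<rho>" using \<rho> M by (simp add: cm_integrable_def)
  have "continuous_on (sphere 0 1) (\<lambda>u :: complex. u powi k)"
    by (intro continuous_intros) auto
  then have "(\<lambda>u. u powi k) \<in> borel_measurable circle_algebra"
    unfolding circle_algebra_def by (rule borel_measurable_continuous_on_restrict)
  then have meas: "(\<lambda>u. u powi k) \<in> borel_measurable M"
    using \<nu>(2) by (simp cong: measurable_cong_sets)
  show "integrable M (\<lambda>u. u powi k * \<rho> u)"
  proof (rule Bochner_Integration.integrable_bound[OF int])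
    show "(\<lambda>u. u powi k * \<rho> u) \<in> borel_measurable M"
      using meas int by measurable
    show "AE u in M. norm (u powi k * \<rho> u) \<le> norm (\<rho> u)"
      using \<nu>(2) by (intro AE_I2) (auto simp: norm_mult norm_power_int)
  qed
qed

lemma cm_integral_diff_scaled:
  assumes "cm_integrable \<mu> f" "cm_integrable \<mu> g"
  shows "cm_integral \<mu> (\<lambda>u. f u - w * g u) = cm_integral \<mu> f - w * cm_integral \<mu> g"
  using assms by (simp add: cm_integral_def cm_integrable_def variation_parts_def algebra_simps)

text \<open>The two Miwa shifts act on moments by the same combinations of neighbours as the row operations
  do on determinants.\<close>

lemma moment_shift:
  assumes \<mu>: "complex_borel_measure \<mu>" and \<rho>: "cm_integrable \<mu> \<rho>"
  shows "moment \<mu> (\<lambda>u. (1 - w * u) * \<rho> u) k = moment \<mu> \<rho> k - w * moment \<mu> \<rho> (k + 1)"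
    and "moment \<mu> (\<lambda>u. (1 - w / u) * \<rho> u) k = moment \<mu> \<rho> k - w * moment \<mu> \<rho> (k - 1)"
proof -
  note int = cm_integrable_power[OF \<mu> \<rho>]
  have "moment \<mu> (\<lambda>u. (1 - w * u) * \<rho> u) k =
      cm_integral \<mu> (\<lambda>u. u powi k * \<rho> u - w * (u powi (k + 1) * \<rho> u))"
    unfolding moment_def
  proof (rule cm_integral_cong)
    fix u :: complex assume "u \<in> sphere 0 1"
    then have "u \<noteq> 0" by auto
    then have "u powi (k + 1) = u powi k * u" by (simp add: power_int_add_1)
    then show "u powi k * ((1 - w * u) * \<rho> u) = u powi k * \<rho> u - w * (u powi (k + 1) * \<rho> u)"
      by (simp only:) (simp add: algebra_simps)
  qed
  then show "moment \<mu> (\<lambda>u. (1 - w * u) * \<rho> u) k = moment \<mu> \<rho> k - w * moment \<mu> \<rho> (k + 1)"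
    by (simp add: cm_integral_diff_scaled[OF int int] moment_def)
  have "moment \<mu> (\<lambda>u. (1 - w / u) * \<rho> u) k =
      cm_integral \<mu> (\<lambda>u. u powi k * \<rho> u - w * (u powi (k - 1) * \<rho> u))"
    unfolding moment_def
  proof (rule cm_integral_cong)
    fix u :: complex assume "u \<in> sphere 0 1"
    then have "u \<noteq> 0" by auto
    then show "u powi k * ((1 - w / u) * \<rho> u) = u powi k * \<rho> u - w * (u powi (k - 1) * \<rho> u)"
      by (simp add: power_int_diff field_simps)
  qed
  then show "moment \<mu> (\<lambda>u. (1 - w / u) * \<rho> u) k = moment \<mu> \<rho> k - w * moment \<mu> \<rho> (k - 1)"
    by (simp add: cm_integral_diff_scaled[OF int int] moment_def)
qed

lemma tau_nonzero:
  assumes qd: "quasi_definite \<mu> \<rho>" and N: "np + nm > 0"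
  shows "det (leading l (moment_matrix np nm \<mu> \<rho>)) \<noteq> 0"
proof (cases l)
  case 0
  then show ?thesis using det_dim_zero[of "leading l (moment_matrix np nm \<mu> \<rho>)"] by simp
next
  case (Suc n)
  have "det (leading l (moment_matrix np nm \<mu> \<rho>)) =
      det (mat l l (\<lambda>(i, j). moment \<mu> \<rho> (chi_exp np nm i - chi_exp np nm j)))"
    by (simp add: leading_def moment_matrix_eq_moment)
  also have "\<dots> = det (mat l l (\<lambda>(i, j). moment \<mu> \<rho> (int i - int j)))"
    by (subst det_reindex[OF exponent_interval[OF N], where f = "\<lambda>a b. moment \<mu> \<rho> (a - b)"]) simp
  also have "\<dots> \<noteq> 0" using qd Suc by (simp add: quasi_definite_def moment_def)
  finally show ?thesis .
qed

section \<open>Orthogonal Laurent polynomials as quotients of tau functions\<close>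

lemma mat_delete_last_leading:
  assumes "\<And>i. i < l \<Longrightarrow> e i = chi_exp np nm i"
  shows "det (mat_delete (mat (Suc l) (Suc l) (\<lambda>(i, j). moment \<mu> \<rho> (e i - e j))) l l) =
    tau np nm \<mu> \<rho> l"
  unfolding tau_def leading_def
  by (intro arg_cong[of _ _ det] eq_matI)
    (use assms in \<open>auto simp: mat_delete_def moment_matrix_eq_moment\<close>)

lemma bordered_as_powers:
  fixes np nm l m :: nat
  defines "e \<equiv> \<lambda>i. chi_exp np nm (if i < l then i else m)"
  shows "bordered (moment_matrix np nm \<mu> \<rho>) l m (\<lambda>j. chi np nm j z) =
    det (mat (Suc l) (Suc l) (\<lambda>(i, j). if j = l then z powi e i else moment \<mu> \<rho> (e i - e j)))"
  unfolding bordered_def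
  by (intro arg_cong[of _ _ det] eq_matI)
    (auto simp: e_def moment_matrix_eq_moment chi_def Let_def)

lemma det_column_powers_leading:
  "det (mat (Suc l) (Suc l) (\<lambda>(i, j). if j = m then chi np nm i z else moment_matrix np nm \<mu> \<rho> i j)) =
   det (mat (Suc l) (Suc l) (\<lambda>(i, j). if j = m then z powi chi_exp np nm i
      else moment \<mu> \<rho> (chi_exp np nm i - chi_exp np nm j)))"
  by (simp add: chi_def moment_matrix_eq_moment cong: if_cong)

lemma tau_minus_moments:
  "tau_minus np nm \<mu> \<rho> a l = (let m = prev_index np nm a l in (-1) ^ (l + m) *
     det (mat_delete (mat (Suc l) (Suc l)
       (\<lambda>(i, j). moment \<mu> \<rho> (chi_exp np nm i - chi_exp np nm j))) l m))"
  by (simp add: tau_minus_def leading_def moment_matrix_eq_moment)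

context
  fixes \<mu> :: "complex set \<Rightarrow> complex" and t :: "nat \<Rightarrow> nat \<Rightarrow> complex"
    and np nm l :: nat and z :: complex
  assumes \<mu>: "complex_borel_measure \<mu>" and int: "cm_integrable \<mu> (deformation t)"
    and N: "np + nm > 0" and z: "z \<noteq> 0"
begin

lemma det_powers_sub1:
  assumes e: "\<And>i. i < l \<Longrightarrow> e i = chi_exp np nm i" "e l = int (kind_count np nm 1 l)" and m: "m \<le> l"
  shows "det (mat (Suc l) (Suc l)
      (\<lambda>(i, j). if j = m then z powi e i else moment \<mu> (deformation t) (e i - e j))) =
    z powi e l * ((-1) ^ (l + m) * det (mat_delete (mat (Suc l) (Suc l)
      (\<lambda>(i, j). moment \<mu> (deformation_sub1 t (inverse z)) (e i - e j))) l m))"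
proof -
  have "bij_betw e {0..<l} {- int (kind_count np nm 2 l)..<- int (kind_count np nm 2 l) + int l}"
    using exponent_interval[OF N] e(1) by (subst bij_betw_cong[of _ e "chi_exp np nm"]) auto
  moreover have "e l = - int (kind_count np nm 2 l) + int l"
    using e(2) kind_count_sum[of np nm l] by linarith
  moreover have "moment \<mu> (deformation_sub1 t (inverse z)) k =
      moment \<mu> (deformation t) k - inverse z * moment \<mu> (deformation t) (k + 1)" for k
    using moment_shift(1)[OF \<mu> int, of "inverse z" k] by (simp add: deformation_sub1_def[abs_def])
  ultimately show ?thesis by (simp only: det_power_column_top[where e = e, OF _ _ m z])
qed

lemma det_powers_add2:
  assumes e: "\<And>i. i < l \<Longrightarrow> e i = chi_exp np nm i" "e l = - int (kind_count np nm 2 l) - 1"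
    and m: "m \<le> l"
  shows "det (mat (Suc l) (Suc l)
      (\<lambda>(i, j). if j = m then z powi e i else moment \<mu> (deformation t) (e i - e j))) =
    z powi e l * ((-1) ^ (l + m) * det (mat_delete (mat (Suc l) (Suc l)
      (\<lambda>(i, j). moment \<mu> (deformation_add2 t z) (e i - e j))) l m))"
proof -
  have "{- int (kind_count np nm 2 l) - 1<..- int (kind_count np nm 2 l) - 1 + int l} =
      {- int (kind_count np nm 2 l)..<- int (kind_count np nm 2 l) + int l}" by auto
  then have "bij_betw e {0..<l}
      {- int (kind_count np nm 2 l) - 1<..- int (kind_count np nm 2 l) - 1 + int l}"
    using exponent_interval[OF N] e(1) by (subst bij_betw_cong[of _ e "chi_exp np nm"]) auto
  moreover have "moment \<mu> (deformation_add2 t z) k =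
      moment \<mu> (deformation t) k - z * moment \<mu> (deformation t) (k - 1)" for k
    using moment_shift(2)[OF \<mu> int, of z k] by (simp add: deformation_add2_def[abs_def])
  ultimately show ?thesis by (simp only: det_power_column_bottom[where e = e, OF _ e(2) m z])
qed

text \<open>The index \<open>m\<close> is the next one of its kind counted from \<open>l\<close>, so its exponent lies right above
  those of the first \<open>l\<close> rows.\<close>

lemma bordered_sub1:
  assumes "kind np nm m = 1" "kind_count np nm 1 m = kind_count np nm 1 l"
  shows "bordered (moment_matrix np nm \<mu> (deformation t)) l m (\<lambda>j. chi np nm j z) =
    z powi chi_exp np nm m * tau np nm \<mu> (deformation_sub1 t (inverse z)) l"
  unfolding bordered_as_powers
  by (subst det_powers_sub1)
    (use assms chi_exp_eq_count[OF N] in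
      \<open>simp_all add: mat_delete_last_leading flip: mult_2\<close>)

text \<open>Here the exponent of \<open>m\<close> lies right below those of the first \<open>l\<close> rows.\<close>

lemma bordered_add2:
  assumes "kind np nm m = 2" "kind_count np nm 2 m = kind_count np nm 2 l"
  shows "bordered (moment_matrix np nm \<mu> (deformation t)) l m (\<lambda>j. chi np nm j z) =
    z powi chi_exp np nm m * tau np nm \<mu> (deformation_add2 t z) l"
  unfolding bordered_as_powers
  by (subst det_powers_add2)
    (use assms chi_exp_eq_count[OF N] in
      \<open>simp_all add: mat_delete_last_leading flip: mult_2\<close>)

text \<open>As \<open>a(l) = 1\<close>, the last row has the largest exponent wherever the column of powers stands.\<close>

lemma column_powers_sub1:
  assumes "kind np nm l = 1" "prev_index np nm a l \<le> l"
  shows "det (mat (Suc l) (Suc l) (\<lambda>(i, j). if j = prev_index np nm a l then chi np nm i z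
      else moment_matrix np nm \<mu> (deformation t) i j)) =
    z powi chi_exp np nm l * tau_minus np nm \<mu> (deformation_sub1 t (inverse z)) a l"
  unfolding det_column_powers_leading
  by (subst det_powers_sub1)
    (use assms chi_exp_eq_count[OF N] in \<open>simp_all add: tau_minus_moments Let_def\<close>)

lemma column_powers_add2:
  assumes "kind np nm l = 2" "prev_index np nm a l \<le> l"
  shows "det (mat (Suc l) (Suc l) (\<lambda>(i, j). if j = prev_index np nm a l then chi np nm i z
      else moment_matrix np nm \<mu> (deformation t) i j)) =
    z powi chi_exp np nm l * tau_minus np nm \<mu> (deformation_add2 t z) a l"
  unfolding det_column_powers_leading
  by (subst det_powers_add2)
    (use assms chi_exp_eq_count[OF N] in \<open>simp_all add: tau_minus_moments Let_def\<close>)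

end

context
  fixes \<mu> :: "complex set \<Rightarrow> complex" and \<rho> :: "complex \<Rightarrow> complex" and np nm :: nat
  assumes qd: "quasi_definite \<mu> \<rho>" and N: "np + nm > 0"
begin

lemma phi1_bordered:
  "phi1 np nm \<mu> \<rho> l z =
     bordered (moment_matrix np nm \<mu> \<rho>) l l (\<lambda>j. chi np nm j z) / tau np nm \<mu> \<rho> l"
  unfolding phi1_def tau_def by (rule S1_row_bordered[OF tau_nonzero[OF qd N]])

lemma phi1_plus_bordered:
  "phi1_plus np nm \<mu> \<rho> a l z =
     bordered (moment_matrix np nm \<mu> \<rho>) l (next_index np nm a l) (\<lambda>j. chi np nm j z)
       / tau np nm \<mu> \<rho> l"
  unfolding phi1_plus_def tau_def Let_def chi_vec_def
  by (rule schur_complement_bordered[OF tau_nonzero[OF qd N]])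

lemma phi1_minus_column:
  assumes "prev_index np nm a l \<le> l"
  shows "phi1_minus np nm \<mu> \<rho> a l z =
     det (mat (Suc l) (Suc l) (\<lambda>(i, j). if j = prev_index np nm a l then chi np nm i z
       else moment_matrix np nm \<mu> \<rho> i j)) / tau np nm \<mu> \<rho> (l + 1)"
  unfolding phi1_minus_def tau_def Let_def chi_vec_def
  using minv_row_cramer[OF tau_nonzero[OF qd N], of "prev_index np nm a l" "l + 1"] assms by simp

text \<open>When \<open>\<chi>\<^sup>(\<^sup>l\<^sup>)\<close> is of kind \<open>a\<close>, both associated indices are \<open>l\<close>: replacing the last column and
  bordering the block of size \<open>l\<close> give the same matrix, and \<open>(S\<^sub>2)\<^sub>l\<^sub>l\<close> exchanges the denominators
  \<open>\<tau>\<^sup>(\<^sup>l\<^sup>+\<^sup>1\<^sup>)\<close> and \<open>\<tau>\<^sup>(\<^sup>l\<^sup>)\<close>.\<close>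

lemma S2_phi1_minus:
  assumes "kind np nm l = a"
  shows "S2 (moment_matrix np nm \<mu> \<rho>) l l * phi1_minus np nm \<mu> \<rho> a l z =
    phi1_plus np nm \<mu> \<rho> a l z"
proof -
  have "det (mat (Suc l) (Suc l) (\<lambda>(i, j). if j = l then chi np nm i z
      else moment_matrix np nm \<mu> \<rho> i j)) =
    bordered (moment_matrix np nm \<mu> \<rho>) l l (\<lambda>j. chi np nm j z)"
    unfolding bordered_def by (intro arg_cong[of _ _ det] eq_matI) (auto simp: less_Suc_eq)
  then show ?thesis
    using assms tau_nonzero[OF qd N, of "Suc l"]
    by (simp add: phi1_minus_column phi1_plus_bordered prev_index_self next_index_self tau_def
        S2_diagonal[OF tau_nonzero[OF qd N]])
qed

end

theorem theorem9:
  fixes \<mu> :: "complex set \<Rightarrow> complex"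
    and t :: "nat \<Rightarrow> nat \<Rightarrow> complex"
    and np nm l :: nat
    and z :: complex
  assumes "complex_borel_measure \<mu>"
    and "deformation_converges t"
    and "cm_integrable \<mu> (deformation t)"
    and "quasi_definite \<mu> (deformation t)"
    and "np \<ge> 1" and "nm \<ge> 1" and "l \<ge> np + nm"
    and "z \<noteq> 0"
  defines "\<rho> \<equiv> deformation t"
    and "\<rho>\<^sub>1 \<equiv> deformation_sub1 t (inverse z)"
    and "\<rho>\<^sub>2 \<equiv> deformation_add2 t z"
  shows
    "(kind np nm l = 1 \<longrightarrow>
        phi1 np nm \<mu> \<rho> l z = phi1_plus np nm \<mu> \<rho> 1 l z \<and>
        phi1_plus np nm \<mu> \<rho> 1 l z
          = S2 (moment_matrix np nm \<mu> \<rho>) l l * phi1_minus np nm \<mu> \<rho> 1 l z \<and>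
        S2 (moment_matrix np nm \<mu> \<rho>) l l * phi1_minus np nm \<mu> \<rho> 1 l z
          = z powi (int (nu_plus np nm l) - 1) * (tau np nm \<mu> \<rho>\<^sub>1 l / tau np nm \<mu> \<rho> l)) \<and>
     (kind np nm l = 2 \<longrightarrow>
        phi1 np nm \<mu> \<rho> l z = phi1_plus np nm \<mu> \<rho> 2 l z \<and>
        phi1_plus np nm \<mu> \<rho> 2 l z
          = S2 (moment_matrix np nm \<mu> \<rho>) l l * phi1_minus np nm \<mu> \<rho> 2 l z \<and>
        S2 (moment_matrix np nm \<mu> \<rho>) l l * phi1_minus np nm \<mu> \<rho> 2 l z
          = z powi (- int (nu_minus np nm l)) * (tau np nm \<mu> \<rho>\<^sub>2 l / tau np nm \<mu> \<rho> l)) \<and>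
     (kind np nm l = 1 \<longrightarrow>
        phi1_plus np nm \<mu> \<rho> 2 l z
          = z powi (- int (nu_minus np nm (next_index np nm 2 l)))
              * (tau np nm \<mu> \<rho>\<^sub>2 l / tau np nm \<mu> \<rho> l)) \<and>
     (kind np nm l = 2 \<longrightarrow>
        phi1_plus np nm \<mu> \<rho> 1 l z
          = z powi (int (nu_plus np nm (next_index np nm 1 l)) - 1)
              * (tau np nm \<mu> \<rho>\<^sub>1 l / tau np nm \<mu> \<rho> l)) \<and>
     (kind np nm l = 1 \<longrightarrow>
        phi1_minus np nm \<mu> \<rho> 2 l z
          = z powi (int (nu_plus np nm l) - 1)
              * (tau_minus np nm \<mu> \<rho>\<^sub>1 2 l / tau np nm \<mu> \<rho> (l + 1))) \<and>
     (kind np nm l = 2 \<longrightarrow>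
        phi1_minus np nm \<mu> \<rho> 1 l z
          = z powi (- int (nu_minus np nm l))
              * (tau_minus np nm \<mu> \<rho>\<^sub>2 1 l / tau np nm \<mu> \<rho> (l + 1)))"
proof -
  have N: "np + nm > 0" using assms(5) by simp
  \<comment> \<open>From \<open>l \<ge> n\<^sub>+ + n\<^sub>-\<close>: both kinds already occur within the first block, at \<open>0\<close> and at \<open>n\<^sub>+\<close>.\<close>
  have prev: "prev_index np nm a l \<le> l" if "a \<in> {1, 2}" for a
  proof -
    have "kind np nm 0 = 1" "kind np nm np = 2"
      using assms(5,6) kind_iff_mod[of np nm 0] kind_iff_mod[of np nm np] kind_cases[of np nm np]
      by auto
    then show ?thesis
      using that assms(7) prev_index_le[of 0 l np nm 1] prev_index_le[of np l np nm 2] by auto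
  qed
  note qd = assms(4)[folded \<rho>_def]
  have next1: "kind np nm (next_index np nm 1 l) = 1"
    and next2: "kind np nm (next_index np nm 2 l) = 2"
    using next_index(1)[OF assms(5,6)] by simp_all
  have plus1: "phi1_plus np nm \<mu> \<rho> 1 l z = z powi (int (nu_plus np nm (next_index np nm 1 l)) - 1)
      * (tau np nm \<mu> \<rho>\<^sub>1 l / tau np nm \<mu> \<rho> l)"
    using bordered_sub1[OF assms(1,3) N assms(8) next_index[OF assms(5,6), of 1 l], folded \<rho>_def \<rho>\<^sub>1_def]
    by (simp add: phi1_plus_bordered[OF qd N] chi_exp_eq_nu(1)[OF N next1] del: One_nat_def)
  have plus2: "phi1_plus np nm \<mu> \<rho> 2 l z = z powi (- int (nu_minus np nm (next_index np nm 2 l)))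
      * (tau np nm \<mu> \<rho>\<^sub>2 l / tau np nm \<mu> \<rho> l)"
    using bordered_add2[OF assms(1,3) N assms(8) next_index[OF assms(5,6), of 2 l], folded \<rho>_def \<rho>\<^sub>2_def]
    by (simp add: phi1_plus_bordered[OF qd N] chi_exp_eq_nu(2)[OF N next2] del: One_nat_def)
  have phi1: "phi1 np nm \<mu> \<rho> l z = phi1_plus np nm \<mu> \<rho> a l z" if "kind np nm l = a" for a
    by (simp add: phi1_bordered[OF qd N] phi1_plus_bordered[OF qd N] next_index_self[OF that])
  have minus1: "phi1_minus np nm \<mu> \<rho> 2 l z = z powi (int (nu_plus np nm l) - 1)
      * (tau_minus np nm \<mu> \<rho>\<^sub>1 2 l / tau np nm \<mu> \<rho> (l + 1))" if "kind np nm l = 1"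
    using column_powers_sub1[OF assms(1,3) N assms(8) that prev, of 2, folded \<rho>_def \<rho>\<^sub>1_def]
    by (simp add: phi1_minus_column[OF qd N prev] chi_exp_eq_nu(1)[OF N that] del: One_nat_def)
  have minus2: "phi1_minus np nm \<mu> \<rho> 1 l z = z powi (- int (nu_minus np nm l))
      * (tau_minus np nm \<mu> \<rho>\<^sub>2 1 l / tau np nm \<mu> \<rho> (l + 1))" if "kind np nm l = 2"
    using column_powers_add2[OF assms(1,3) N assms(8) that prev, of 1, folded \<rho>_def \<rho>\<^sub>2_def]
    by (simp add: phi1_minus_column[OF qd N prev] chi_exp_eq_nu(2)[OF N that] del: One_nat_def)
  show ?thesis
    using phi1 S2_phi1_minus[OF qd N] plus1 plus2 minus1 minus2
    by (simp add: next_index_self del: One_nat_def)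
qed

end
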